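(* Let $n>100$ and let $P$ be a set of $n$ points in general position in the plane (no three points of $P$ are collinear). Let $R$ be a set of points disjoint from $P$ such that every line through two distinct points of $P$ passes through a point of $R$. Assume that $P\cup R$ is contained in a reducible cubic curve $c$ that is the union of a quadric $Q$ and a line $\ell$. If $n\le |R|<\frac{3}{2}n$ and $\ell$ is the line at infinity, then $Q$ must be an ellipse, $P\subset Q$, and, up to an affine transformation, $P$ is a subset of the set of vertices of a regular $m$-gon for some $m\le |R|$. The bound $\frac{3}{2}n$ is best possible: for every even $n>100$ there exist a circle $Q$, a set $P\subset Q$ of $n$ points (hence in general position), and a set $R$ of exactly $\frac{3}{2}n$ points on the line at infinity such that every line through two distinct points of $P$ passes through a point of $R$, but $P$ is not contained in any affine image of the set of vertices of a regular polygon.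
   Context: The plane is the real plane together with its line at infinity (the real projective plane); a point on the line at infinity corresponds to a direction of lines in $\mathbb{R}^2$, and a line passes through that point if and only if it has that direction. A quadric means an irreducible (nondegenerate) real conic: an ellipse, a parabola or a hyperbola. Circles are ellipses. "Up to an affine transformation" means that there is an invertible affine map of $\mathbb{R}^2$ whose image of $P$ has the stated property. *)

theory Defs
  imports "HOL-Analysis.Analysis"
begin

section \<open>The real projective plane as the affine plane with its line at infinity\<close>

typedef direction = "{D :: (real^2) set. subspace D \<and> dim D = 1}"
  morphisms vectors_of Direction
proof
  show "span {axis 1 1 :: real^2} \<in> {D. subspace D \<and> dim D = 1}"
    by (simp add: dim_span dim_singleton axis_eq_0_iff)
qed

datatype ppoint = Aff "real^2" | At_Inf direction

definition line_at_infinity :: "ppoint set" where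
  "line_at_infinity = range At_Inf"

definition affine_line :: "real^2 \<Rightarrow> direction \<Rightarrow> ppoint set" where
  "affine_line a d = Aff ` {x. x - a \<in> vectors_of d} \<union> {At_Inf d}"

definition is_line :: "ppoint set \<Rightarrow> bool" where
  "is_line L \<longleftrightarrow> L = line_at_infinity \<or> (\<exists>a d. L = affine_line a d)"

definition general_position :: "ppoint set \<Rightarrow> bool" where
  "general_position P \<longleftrightarrow>
     (\<forall>p\<in>P. \<forall>q\<in>P. \<forall>r\<in>P. p \<noteq> q \<and> q \<noteq> r \<and> p \<noteq> r \<longrightarrow>
        \<not> (\<exists>L. is_line L \<and> {p, q, r} \<subseteq> L))"

definition blocks_lines :: "ppoint set \<Rightarrow> ppoint set \<Rightarrow> bool" where
  "blocks_lines R P \<longleftrightarrow>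
     (\<forall>p\<in>P. \<forall>q\<in>P. p \<noteq> q \<longrightarrow>
        (\<forall>L. is_line L \<and> p \<in> L \<and> q \<in> L \<longrightarrow> (\<exists>r\<in>R. r \<in> L)))"


section \<open>Conics\<close>

definition homogeneous :: "real^2 \<Rightarrow> real \<Rightarrow> real^3" where
  "homogeneous x w = vector [x $ 1, x $ 2, w]"

text \<open>The projective zero set of the quadratic form with matrix \<open>M\<close>. Its affine points are the
  solutions of \<open>M11 x^2 + 2 M12 x y + M22 y^2 + 2 M13 x + 2 M23 y + M33 = 0\<close>, its points at
  infinity the directions on which the leading form vanishes (asymptotes of a hyperbola, axis of
  a parabola).\<close>

definition conic :: "real^3^3 \<Rightarrow> ppoint set" where
  "conic M =
     Aff ` {x. homogeneous x 1 \<bullet> (M *v homogeneous x 1) = 0} \<union>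
     At_Inf ` {d. \<forall>v\<in>vectors_of d. homogeneous v 0 \<bullet> (M *v homogeneous v 0) = 0}"

text \<open>Nonemptiness excludes the definite forms, e.g. \<open>x^2 + y^2 + 1 = 0\<close>, which are
  nondegenerate but have no real points.\<close>

definition nondegenerate_real_conic :: "real^3^3 \<Rightarrow> bool" where
  "nondegenerate_real_conic M \<longleftrightarrow> transpose M = M \<and> det M \<noteq> 0 \<and> conic M \<noteq> {}"

text \<open>The leading form has determinant \<open>M11 M22 - M12^2\<close>; a nondegenerate real conic is an ellipse,
  a parabola or a hyperbola according to whether this is positive, zero or negative.\<close>

definition is_quadric :: "ppoint set \<Rightarrow> bool" where
  "is_quadric Q \<longleftrightarrow> (\<exists>M. nondegenerate_real_conic M \<and> Q = conic M)"

definition is_ellipse :: "ppoint set \<Rightarrow> bool" where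
  "is_ellipse Q \<longleftrightarrow>
     (\<exists>M. nondegenerate_real_conic M \<and> M $ 1 $ 1 * M $ 2 $ 2 - (M $ 1 $ 2)\<^sup>2 > 0 \<and> Q = conic M)"

definition is_circle :: "ppoint set \<Rightarrow> bool" where
  "is_circle Q \<longleftrightarrow> (\<exists>z \<rho>. \<rho> > 0 \<and> Q = Aff ` sphere z \<rho>)"


section \<open>Affine maps and regular polygons\<close>

definition affine_map :: "(real^2 \<Rightarrow> real^2) \<Rightarrow> bool" where
  "affine_map f \<longleftrightarrow> (\<exists>g b. linear g \<and> f = (\<lambda>x. g x + b))"

definition regular_polygon_vertices :: "nat \<Rightarrow> (real^2) set \<Rightarrow> bool" where
  "regular_polygon_vertices m V \<longleftrightarrow>
     m \<ge> 3 \<and>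
     (\<exists>z \<rho> \<phi>. \<rho> > 0 \<and>
        V = (\<lambda>k. z + \<rho> *\<^sub>R vector [cos (\<phi> + 2 * pi * real k / real m),
                                     sin (\<phi> + 2 * pi * real k / real m)]) ` {..<m})"

end

theory Submission
  imports Defs "HOL-Computational_Algebra.Polynomial"
begin

text \<open>A point of \<open>P\<close> at infinity would force almost \<open>n\<close> affine points in \<open>R\<close> besides almost \<open>n\<close> points at
  infinity, so \<open>P \<subseteq> Q\<close> and \<open>R\<close> contains the directions of all chords of \<open>P\<close>. The affine part of a conic
  is a subset of the multiplicative group of the complex numbers (the unit circle, the nonzero reals or
  the positive reals) in which the direction of a chord determines the product of its endpoints. Hence
  \<open>P\<close> becomes a set \<open>A\<close> of \<open>n\<close> nonzero numbers with fewer than \<open>3 n / 2\<close> products of distinct elements.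
  An energy estimate shows that then every square of an element is also such a product; as
  \<open>\<bar>A A\<bar> < 3 n / 2\<close>, the ratios of elements of \<open>A\<close> form a group, of order at most \<open>\<bar>A A\<bar>\<close>. So \<open>A\<close> lies in a
  coset of a group of roots of unity, which is impossible for real numbers.

  For sharpness, take \<open>P\<close> to be two cosets \<open>H\<close> and \<open>\<zeta> H\<close> of the group of \<open>n / 2\<close>-th roots of unity where
  \<open>\<zeta>\<close> is not a root of unity. An affine image of a regular polygon lies on an ellipse, and an ellipse
  meeting the unit circle in more than four points is the unit circle.\<close>

section \<open>Small product sets in a field\<close>

lemma sum_card_fibres:
  assumes "finite U"
  shows "(\<Sum>v\<in>f ` U. card {u\<in>U. f u = v}) = card U"
  using sum.image_gen[OF assms, of "\<lambda>_. 1::nat" f] by simp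

lemma sum_card_fibres_squared:
  assumes "finite U"
  shows "(\<Sum>v\<in>f ` U. (card {u\<in>U. f u = v})\<^sup>2) = card {(u, u'). u \<in> U \<and> u' \<in> U \<and> f u = f u'}"
proof -
  have eq: "{(u, u'). u \<in> U \<and> u' \<in> U \<and> f u = f u'} = (\<Union>v\<in>f ` U. {u\<in>U. f u = v} \<times> {u\<in>U. f u = v})"
    by auto
  have "card (\<Union>v\<in>f ` U. {u\<in>U. f u = v} \<times> {u\<in>U. f u = v}) =
      (\<Sum>v\<in>f ` U. card ({u\<in>U. f u = v} \<times> {u\<in>U. f u = v}))"
    by (rule card_UN_disjoint) (use assms in auto)
  then show ?thesis
    unfolding eq by (simp add: card_cartesian_product power2_eq_square)
qed

lemma card_Int_lower:
  assumes "finite C" "A \<subseteq> C" "B \<subseteq> C"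
  shows "card A + card B \<le> card C + card (A \<inter> B)"
proof -
  have "finite A" "finite B"
    using assms finite_subset by auto
  then have "card A + card B = card (A \<union> B) + card (A \<inter> B)"
    by (rule card_Un_Int)
  moreover have "card (A \<union> B) \<le> card C"
    using assms by (intro card_mono) auto
  ultimately show ?thesis by linarith
qed

section \<open>Ratios, products of distinct elements and multiplicative energy\<close>

definition ratios :: "'a::field set \<Rightarrow> 'a set" where
  "ratios A = (\<lambda>(x, y). x / y) ` (A \<times> A)"

definition ratio_count :: "'a::field set \<Rightarrow> 'a \<Rightarrow> nat" where
  "ratio_count A d = card {u\<in>A \<times> A. (\<lambda>(x, y). x / y) u = d}"

definition distinct_products :: "'a::field set \<Rightarrow> 'a set" where
  "distinct_products A = (\<lambda>(x, y). x * y) ` {(x, y). x \<in> A \<and> y \<in> A \<and> x \<noteq> y}"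

lemma distinct_productsI: "x \<in> A \<Longrightarrow> y \<in> A \<Longrightarrow> x \<noteq> y \<Longrightarrow> x * y \<in> distinct_products A"
  unfolding distinct_products_def by force

lemma ratiosI: "x \<in> A \<Longrightarrow> y \<in> A \<Longrightarrow> x / y \<in> ratios A"
  unfolding ratios_def by force

lemma finite_ratios: "finite A \<Longrightarrow> finite (ratios A)"
  unfolding ratios_def by simp

lemma finite_distinct_products:
  assumes "finite A"
  shows "finite (distinct_products A)"
proof -
  have "distinct_products A \<subseteq> (\<lambda>(x, y). x * y) ` (A \<times> A)"
    unfolding distinct_products_def by auto
  then show ?thesis
    using assms finite_subset by blast
qed

lemma ratio_count_eq:
  assumes "0 \<notin> A"
  shows "ratio_count A d = card {z\<in>A. d * z \<in> A}"
proof -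
  have "{u\<in>A \<times> A. (\<lambda>(x, y). x / y) u = d} = (\<lambda>z. (d * z, z)) ` {z\<in>A. d * z \<in> A}"
    using assms by (auto simp: image_iff field_simps)
  moreover have "inj_on (\<lambda>z. (d * z, z)) {z\<in>A. d * z \<in> A}"
    by (auto simp: inj_on_def)
  ultimately show ?thesis
    unfolding ratio_count_def by (simp add: card_image)
qed

text \<open>The dilates of \<open>B\<close> by \<open>b\<close> and of \<open>C\<close> by
  \<open>c\<close> share the container \<open>T\<close>, so they overlap in at least |B| + |C| - |T|
  points. A common point \<open>b * x = c * y\<close> means that \<open>b / c\<close> multiplies
  \<open>x\<close> into \<open>A\<close>, which is one representation of
  \<open>b / c\<close>.\<close>

lemma ratio_count_ge:
  fixes A :: "'a::field set"
  assumes "finite A" "0 \<notin> A" "b \<in> A" "c \<in> A" "finite T"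
    and "B \<subseteq> A" "C \<subseteq> A" "(*) b ` B \<subseteq> T" "(*) c ` C \<subseteq> T"
  shows "card B + card C \<le> card T + ratio_count A (b / c)"
proof -
  have nz: "b \<noteq> 0" "c \<noteq> 0"
    using assms by auto
  have fin: "finite B" "finite C"
    using assms finite_subset by auto
  have "card ((*) b ` B) = card B" "card ((*) c ` C) = card C"
    using nz by (auto intro!: card_image simp: inj_on_def)
  moreover have "card ((*) b ` B \<inter> (*) c ` C) \<le> ratio_count A (b / c)"
  proof -
    have "(\<lambda>s. s / b) ` ((*) b ` B \<inter> (*) c ` C) \<subseteq> {z\<in>A. b / c * z \<in> A}"
    proof
      fix z assume "z \<in> (\<lambda>s. s / b) ` ((*) b ` B \<inter> (*) c ` C)"
      then obtain x y where xy: "x \<in> B" "y \<in> C" "b * x = c * y" "z = b * x / b"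
        by auto
      moreover from this have "z = x"
        using nz by (metis nonzero_mult_div_cancel_left)
      moreover have "b / c * x = y"
        using xy(3) nz by simp
      ultimately show "z \<in> {z\<in>A. b / c * z \<in> A}"
        using xy assms by auto
    qed
    moreover have "inj_on (\<lambda>s. s / b) ((*) b ` B \<inter> (*) c ` C)"
      using nz by (auto simp: inj_on_def)
    ultimately show ?thesis
      unfolding ratio_count_eq[OF assms(2)]
      by (intro card_inj_on_le) (use assms(1) in auto)
  qed
  ultimately show ?thesis
    using card_Int_lower[OF assms(5) assms(8) assms(9)] by linarith
qed

lemma ratio_count_le:
  assumes "finite A" "0 \<notin> A"
  shows "ratio_count A d \<le> card A"
  unfolding ratio_count_eq[OF assms(2)] by (rule card_mono) (use assms in auto)

lemma sum_ratio_count: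
  assumes "finite A"
  shows "(\<Sum>d\<in>ratios A. ratio_count A d) = (card A)\<^sup>2"
  unfolding ratios_def ratio_count_def
  using sum_card_fibres[of "A \<times> A"] assms by (simp add: card_cartesian_product power2_eq_square)

text \<open>Both sides bound the multiplicative energy, the number of solutions of \<open>x y = z w\<close> in \<open>A\<close>.\<close>

lemma energy_bound:
  fixes A :: "'a::field set"
  assumes "finite A" "0 \<notin> A"
  shows "(card A * (card A - 1))\<^sup>2 \<le> card (distinct_products A) * (\<Sum>d\<in>ratios A. (ratio_count A d)\<^sup>2)"
proof -
  define U where "U = {(x, y). x \<in> A \<and> y \<in> A \<and> x \<noteq> y}"
  define f where "f = (\<lambda>(x, y). x * y :: 'a)"
  define g where "g = (\<lambda>(x, y). x / y :: 'a)"
  define r where "r = (\<lambda>s. card {u\<in>U. f u = s})"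
  have U: "U = A \<times> A - (\<lambda>x. (x, x)) ` A"
    unfolding U_def by auto
  have finU: "finite U"
    unfolding U using assms by simp
  have cardU: "card U = card A * (card A - 1)"
  proof -
    have "card U = card (A \<times> A) - card ((\<lambda>x. (x, x)) ` A)"
      unfolding U by (rule card_Diff_subset) (use assms in auto)
    also have "card ((\<lambda>x. (x, x)) ` A) = card A"
      by (rule card_image) (auto simp: inj_on_def)
    finally show ?thesis
      by (simp add: card_cartesian_product diff_mult_distrib2)
  qed
  have S: "distinct_products A = f ` U"
    unfolding distinct_products_def U_def f_def by simp
  \<comment> \<open>Cauchy-Schwarz over the products; \<open>r s\<close> counts the ordered
    representations of \<open>s\<close>.\<close>
  have "(\<Sum>s\<in>f ` U. r s)\<^sup>2 \<le> card (f ` U) * (\<Sum>s\<in>f ` U. (r s)\<^sup>2)"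
  proof -
    have "(\<Sum>s\<in>f ` U. real (r s))\<^sup>2 \<le> (\<Sum>s\<in>f ` U. (real (r s))\<^sup>2) * card (f ` U)"
      by (rule sum_squared_le_sum_of_squares)
    then have "real ((\<Sum>s\<in>f ` U. r s)\<^sup>2) \<le> real (card (f ` U) * (\<Sum>s\<in>f ` U. (r s)\<^sup>2))"
      by (simp add: mult.commute)
    then show ?thesis
      by (simp only: of_nat_le_iff)
  qed
  moreover have "(\<Sum>s\<in>f ` U. r s) = card U"
    unfolding r_def by (rule sum_card_fibres[OF finU])
  moreover have "(\<Sum>s\<in>f ` U. (r s)\<^sup>2) \<le> (\<Sum>d\<in>ratios A. (ratio_count A d)\<^sup>2)"
  proof -
    have 1: "(\<Sum>s\<in>f ` U. (r s)\<^sup>2) = card {(u, u'). u \<in> U \<and> u' \<in> U \<and> f u = f u'}"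
      unfolding r_def by (rule sum_card_fibres_squared[OF finU])
    have 2: "(\<Sum>d\<in>ratios A. (ratio_count A d)\<^sup>2) =
        card {(u, u'). u \<in> A \<times> A \<and> u' \<in> A \<times> A \<and> g u = g u'}"
      unfolding ratios_def ratio_count_def g_def
      by (rule sum_card_fibres_squared) (use assms in simp)
    have fin: "finite {(u, u'). u \<in> A \<times> A \<and> u' \<in> A \<times> A \<and> g u = g u'}"
      by (rule finite_subset[of _ "(A \<times> A) \<times> (A \<times> A)"]) (use assms in auto)
    show ?thesis
      unfolding 1 2
    proof (rule card_inj_on_le[OF _ _ fin])
      \<comment> \<open>Rewriting \<open>x * y = z * w\<close> as \<open>x / z = w / y\<close>
        injects coincidences of products into coincidences of ratios.\<close>
      let ?h = "\<lambda>((x, y), (z, w)). ((x, z), (w, y)) :: ('a \<times> 'a) \<times> ('a \<times> 'a)"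
      show "inj_on ?h {(u, u'). u \<in> U \<and> u' \<in> U \<and> f u = f u'}"
        by (auto simp: inj_on_def)
      show "?h ` {(u, u'). u \<in> U \<and> u' \<in> U \<and> f u = f u'} \<subseteq>
          {(u, u'). u \<in> A \<times> A \<and> u' \<in> A \<times> A \<and> g u = g u'}"
      proof -
        have "x / z = w / y" if "x * y = z * w" "y \<in> A" "z \<in> A" for x y z w
        proof -
          have "y \<noteq> 0" "z \<noteq> 0"
            using that assms(2) by auto
          then show ?thesis
            using that(1) by (simp add: frac_eq_eq mult.commute)
        qed
        then show ?thesis
          unfolding U_def f_def g_def by auto
      qed
    qed
  qed
  ultimately have "(card U)\<^sup>2 \<le> card (f ` U) * (\<Sum>s\<in>f ` U. (r s)\<^sup>2)"
    and "(\<Sum>s\<in>f ` U. (r s)\<^sup>2) \<le> (\<Sum>d\<in>ratios A. (ratio_count A d)\<^sup>2)"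
    by simp_all
  then show ?thesis
    unfolding S cardU using mult_le_mono2 order.trans by blast
qed

text \<open>The quotients x / a and a / y form two families of |A| ratios each. A common value gives
  \<open>x * y = a\<^sup>2\<close>, which the hypothesis allows only for \<open>x = y\<close>, so
  the common ratio is 1 or -1.\<close>

lemma card_ratios_ge:
  fixes A :: "'a::field set"
  assumes "finite A" "0 \<notin> A" "a \<in> A" "a\<^sup>2 \<notin> distinct_products A"
  shows "2 * card A \<le> card (ratios A) + 2"
proof -
  have nz: "a \<noteq> 0"
    using assms by auto
  let ?B = "(\<lambda>x. x / a) ` A" and ?C = "(\<lambda>x. a / x) ` A"
  have "card ?B = card A" "card ?C = card A"
    using assms nz by (auto intro!: card_image simp: inj_on_def field_simps)
  moreover have "?B \<inter> ?C \<subseteq> {1, - 1}"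
  proof
    fix d assume "d \<in> ?B \<inter> ?C"
    then obtain x y where xy: "x \<in> A" "y \<in> A" "d = x / a" "x / a = a / y"
      by auto
    have "y \<noteq> 0"
      using xy assms by auto
    then have "x * y = a\<^sup>2"
      using xy nz by (simp add: field_simps power2_eq_square)
    then have "x = y"
      using distinct_productsI[of x A y] xy assms by auto
    then have "x = a \<or> x = - a"
      using \<open>x * y = a\<^sup>2\<close> by (metis power2_eq_iff power2_eq_square)
    then show "d \<in> {1, - 1}"
      using xy nz by auto
  qed
  then have "card (?B \<inter> ?C) \<le> card {1, - 1 :: 'a}"
    by (rule card_mono[rotated]) simp
  moreover have "card {1, - 1 :: 'a} \<le> 2"
    by (simp add: card_insert_if)
  moreover have "?B \<subseteq> ratios A" "?C \<subseteq> ratios A"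
    using assms by (auto intro: ratiosI)
  ultimately show ?thesis
    using card_Int_lower[OF finite_ratios[OF assms(1)], of ?B ?C] by linarith
qed

text \<open>If \<open>a\<^sup>2\<close> is not a product of distinct elements, the ratios are numerous and hence each is
  represented only about \<open>n / 2\<close> times, so the energy is too small for such a small product set.\<close>

lemma squares_in_distinct_products:
  fixes A :: "'a::field set"
  assumes "finite A" "0 \<notin> A" "card A > 20"
    and small: "2 * card (distinct_products A) < 3 * card A" and "a \<in> A"
  shows "a\<^sup>2 \<in> distinct_products A"
proof (rule ccontr)
  assume notin: "a\<^sup>2 \<notin> distinct_products A"
  define n where "n = real (card A)"
  \<comment> \<open>This is 2 (n - 1) minus the largest possible size (3 n - 1) / 2 of the product
    set: the bound from \<open>ratio_count_ge\<close> when \<open>b\<close> and \<open>c\<close> are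
    removed from the two copies of \<open>A\<close> to keep the factors distinct.\<close>
  define p where "p = (n - 3) / 2"
  define N where "N = (\<lambda>d. real (ratio_count A d))"
  define D where "D = real (card (ratios A))"
  have n: "n \<ge> 21"
    unfolding n_def using assms by linarith
  have S: "real (card (distinct_products A)) \<le> (3 * n - 1) / 2"
  proof -
    have "2 * card (distinct_products A) + 1 \<le> 3 * card A"
      using small by simp
    then have "real (2 * card (distinct_products A) + 1) \<le> real (3 * card A)"
      by (rule of_nat_mono)
    then show ?thesis
      unfolding n_def by simp
  qed
  have D: "D \<ge> 2 * n - 2"
    unfolding D_def n_def using card_ratios_ge[OF assms(1,2,5) notin] by linarith
  have Nle: "N d \<le> n" for d
    unfolding N_def n_def using ratio_count_le[OF assms(1,2)] by simp
  have Nge: "N d \<ge> p" if d: "d \<in> ratios A" for d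
  proof -
    obtain b c where bc: "b \<in> A" "c \<in> A" "d = b / c"
      using d unfolding ratios_def by auto
    have "card (A - {b}) + card (A - {c}) \<le> card (distinct_products A) + ratio_count A (b / c)"
      using bc assms finite_distinct_products[OF assms(1)]
      by (intro ratio_count_ge) (auto intro: distinct_productsI)
    moreover have "card (A - {b}) = card A - 1" "card (A - {c}) = card A - 1"
      using bc by auto
    ultimately have "4 * card A \<le> 2 * card (distinct_products A) + 2 * ratio_count A d + 4"
      unfolding bc by linarith
    then have "real (4 * card A) \<le> real (2 * card (distinct_products A) + 2 * ratio_count A d + 4)"
      by (rule of_nat_mono)
    then show ?thesis
      unfolding N_def p_def n_def using S unfolding n_def by simp
  qed
  have sumN: "(\<Sum>d\<in>ratios A. N d) = n\<^sup>2"
    unfolding N_def n_def using sum_ratio_count[OF assms(1)] by (metis of_nat_power of_nat_sum)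
  \<comment> \<open>As each \<open>N d\<close> lies between \<open>p\<close> and \<open>n\<close>,
    no summand is negative; expanding bounds the second moment by the first moment and the number of
    ratios.\<close>
  have "0 \<le> (\<Sum>d\<in>ratios A. (N d - p) * (n - N d))"
    using Nle Nge by (intro sum_nonneg) simp
  also have "\<dots> = (\<Sum>d\<in>ratios A. (n + p) * N d - (N d)\<^sup>2 - n * p)"
    by (intro sum.cong) (auto simp: algebra_simps power2_eq_square)
  also have "\<dots> = (n + p) * (\<Sum>d\<in>ratios A. N d) - (\<Sum>d\<in>ratios A. (N d)\<^sup>2) - n * p * D"
    unfolding D_def by (simp add: sum_subtractf sum_distrib_left)
  finally have "(\<Sum>d\<in>ratios A. (N d)\<^sup>2) \<le> (n + p) * n\<^sup>2 - n * p * D"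
    unfolding sumN by linarith
  also have "\<dots> \<le> (n + p) * n\<^sup>2 - n * p * (2 * n - 2)"
    using D n by (auto intro!: mult_left_mono simp: p_def)
  also have "\<dots> = n * (n - 1) * (n + 6) / 2"
    unfolding p_def by (simp add: field_simps power2_eq_square)
  finally have E: "(\<Sum>d\<in>ratios A. (N d)\<^sup>2) \<le> n * (n - 1) * (n + 6) / 2" .
  have "real ((card A * (card A - 1))\<^sup>2) \<le>
      real (card (distinct_products A) * (\<Sum>d\<in>ratios A. (ratio_count A d)\<^sup>2))"
    using energy_bound[OF assms(1,2)] of_nat_le_iff by blast
  then have "(n * (n - 1))\<^sup>2 \<le> real (card (distinct_products A)) * (\<Sum>d\<in>ratios A. (N d)\<^sup>2)"
    unfolding n_def N_def using assms(3) by (simp add: of_nat_diff)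
  also have "\<dots> \<le> (3 * n - 1) / 2 * (n * (n - 1) * (n + 6) / 2)"
    using S E by (intro mult_mono) (use n in \<open>auto intro: sum_nonneg\<close>)
  \<comment> \<open>Dividing by \<open>n * (n - 1)\<close> leaves n^2 - 21 n + 6 \<le> 0, whence the
    threshold 20 on \<open>card A\<close>.\<close>
  finally have "(n * (n - 1)) * (4 * (n * (n - 1))) \<le> (n * (n - 1)) * ((3 * n - 1) * (n + 6))"
    by (simp add: power2_eq_square field_simps)
  then have "4 * (n * (n - 1)) \<le> (3 * n - 1) * (n + 6)"
    using n by (simp add: mult_le_cancel_left)
  then have "n * (n - 21) + 6 \<le> 0"
    by (simp add: algebra_simps)
  moreover have "n * (n - 21) \<ge> 0"
    using n by simp
  ultimately show False by linarith
qed

section \<open>The group of ratios\<close>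

text \<open>Each ratio is represented by more than half of \<open>A\<close>, which makes the ratios
  closed under multiplication. The exponent \<open>m\<close> is the order of this finite group,
  bounded above because a whole coset of it lies in the product set.\<close>

lemma small_distinct_products_roots_of_unity:
  fixes A :: "'a::field set"
  assumes "finite A" "0 \<notin> A" "card A > 20"
    and small: "2 * card (distinct_products A) < 3 * card A"
  obtains m where "card A \<le> m" "m \<le> card (distinct_products A)"
    and "\<And>x y. x \<in> A \<Longrightarrow> y \<in> A \<Longrightarrow> (x / y) ^ m = 1"
proof -
  let ?S = "distinct_products A" and ?D = "ratios A"
  have prod: "x * y \<in> ?S" if "x \<in> A" "y \<in> A" for x y
    using distinct_productsI[of x A y] squares_in_distinct_products[OF assms, of x] that
    by (cases "x = y") (auto simp: power2_eq_square)
  have finD: "finite ?D"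
    by (rule finite_ratios[OF assms(1)])
  have nzD: "d \<noteq> 0" if "d \<in> ?D" for d
    using that assms(2) unfolding ratios_def by auto
  \<comment> \<open>With squares available no element has to be removed, so there are at least 2 |A|
    - |S| > |A| / 2 representations.\<close>
  have popular: "card A < 2 * ratio_count A d" if d: "d \<in> ?D" for d
  proof -
    obtain b c where bc: "b \<in> A" "c \<in> A" "d = b / c"
      using d unfolding ratios_def by auto
    have "card A + card A \<le> card ?S + ratio_count A (b / c)"
      using bc assms finite_distinct_products[OF assms(1)]
      by (intro ratio_count_ge) (auto intro: prod)
    then show ?thesis
      unfolding bc(3) using small by linarith
  qed
  have inv: "1 / d \<in> ?D" if "d \<in> ?D" for d
    using that unfolding ratios_def by force
  have closed: "d * e \<in> ?D" if de: "d \<in> ?D" "e \<in> ?D" for d e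
  proof -
    \<comment> \<open>Both sets contain more than half of \<open>A\<close>. A common
      \<open>z\<close> gives \<open>d * e = (d * z) / (z / e)\<close>, a quotient of two elements of
      \<open>A\<close>.\<close>
    let ?X = "{z\<in>A. d * z \<in> A}" and ?Y = "{z\<in>A. 1 / e * z \<in> A}"
    have "card ?X + card ?Y \<le> card A + card (?X \<inter> ?Y)"
      by (rule card_Int_lower) (use assms in auto)
    moreover have "card A < 2 * card ?X" "card A < 2 * card ?Y"
      using popular[OF de(1)] popular[OF inv[OF de(2)]] unfolding ratio_count_eq[OF assms(2)] by auto
    ultimately have "card (?X \<inter> ?Y) \<noteq> 0"
      by linarith
    then obtain z where "z \<in> ?X \<inter> ?Y"
      by (metis card.empty ex_in_conv)
    then have z: "d * z \<in> A" "z / e \<in> A" "z \<noteq> 0"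
      using assms(2) by auto
    then have "d * e = (d * z) / (z / e)"
      using nzD[OF de(2)] by (simp add: field_simps)
    then show ?thesis
      using z ratiosI by metis
  qed
  \<comment> \<open>The |A|^2 ordered pairs are distributed over the ratios with more than |A| / 2
    pairs each.\<close>
  have D: "card ?D < 2 * card A"
  proof -
    have ne: "?D \<noteq> {}"
      unfolding ratios_def using assms(3) by auto
    have "card ?D * card A = (\<Sum>d\<in>?D. card A)"
      by simp
    also have "\<dots> < (\<Sum>d\<in>?D. 2 * ratio_count A d)"
      by (rule sum_strict_mono) (use finD ne popular in auto)
    also have "\<dots> = 2 * (card A)\<^sup>2"
      using sum_ratio_count[OF assms(1)] by (simp add: sum_distrib_left[symmetric])
    finally show ?thesis
      by (simp add: power2_eq_square)
  qed
  obtain a where a: "a \<in> A" "a \<noteq> 0"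
    using assms(2,3) by (metis all_not_in_conv card.empty not_less_zero)
  let ?B = "(\<lambda>x. x / a) ` A"
  have B: "card ?B = card A" "?B \<subseteq> ?D"
    using a by (auto intro!: card_image ratiosI simp: inj_on_def)
  \<comment> \<open>As \<open>?B\<close> fills more than half of \<open>?D\<close>, it meets the set
    of all \<open>h / t\<close> with \<open>t\<close> in \<open>?B\<close>. So \<open>h\<close> is a
    product of two elements of \<open>?B\<close>, and \<open>a\<^sup>2 * h\<close> one of two
    elements of \<open>A\<close>.\<close>
  have "(\<lambda>h. a\<^sup>2 * h) ` ?D \<subseteq> ?S"
  proof
    fix s assume "s \<in> (\<lambda>h. a\<^sup>2 * h) ` ?D"
    then obtain h where h: "h \<in> ?D" "s = a\<^sup>2 * h"
      by auto
    let ?C = "(\<lambda>y. h * (a / y)) ` A"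
    have "card ?C = card A"
      using a nzD[OF h(1)] assms(2) by (intro card_image) (auto simp: inj_on_def field_simps)
    moreover have "?C \<subseteq> ?D"
      using a(1) h(1) by (blast intro: closed ratiosI)
    ultimately have "card (?B \<inter> ?C) \<noteq> 0"
      using card_Int_lower[OF finD B(2), of ?C] B D by linarith
    then obtain t where "t \<in> ?B \<inter> ?C"
      by (metis card.empty ex_in_conv)
    then obtain x y where xy: "x \<in> A" "y \<in> A" "x / a = h * (a / y)"
      by auto
    have "y \<noteq> 0"
      using xy assms(2) by auto
    then have "s = x * y"
      using xy a h by (simp add: field_simps power2_eq_square)
    then show "s \<in> ?S"
      using prod xy by simp
  qed
  moreover have "card ((\<lambda>h. a\<^sup>2 * h) ` ?D) = card ?D"
    using a by (intro card_image) (auto simp: inj_on_def)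
  ultimately have "card ?D \<le> card ?S"
    using card_mono[OF finite_distinct_products[OF assms(1)]] by metis
  moreover have "card A \<le> card ?D"
    using B card_mono[OF finD] by metis
  \<comment> \<open>Lagrange's theorem by Euler's argument: multiplication by \<open>?h\<close>
    permutes \<open>?D\<close>, so the product over \<open>?D\<close> is unchanged by the factor
    \<open>?h ^ card ?D\<close>.\<close>
  moreover have "(x / y) ^ card ?D = 1" if "x \<in> A" "y \<in> A" for x y
  proof -
    let ?h = "x / y"
    have h: "?h \<in> ?D" "?h \<noteq> 0"
      using ratiosI[OF that] nzD[OF ratiosI[OF that]] by auto
    have inj: "inj_on ((*) ?h) ?D"
      using h(2) unfolding inj_on_def by (metis mult_cancel_left)
    have "(*) ?h ` ?D \<subseteq> ?D"
      using closed[OF h(1)] by blast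
    then have "(*) ?h ` ?D = ?D"
      using endo_inj_surj[OF finD] inj by blast
    then have "(\<Prod>d\<in>?D. d) = (\<Prod>d\<in>?D. ?h * d)"
      using inj by (metis (no_types, lifting) prod.reindex_cong)
    also have "\<dots> = ?h ^ card ?D * (\<Prod>d\<in>?D. d)"
      by (subst prod.distrib) simp
    finally have "(?h ^ card ?D - 1) * (\<Prod>d\<in>?D. d) = 0"
      by (simp add: algebra_simps)
    moreover have "(\<Prod>d\<in>?D. d) \<noteq> 0"
      using finD nzD by auto
    ultimately show ?thesis
      by (metis eq_iff_diff_eq_0 mult_eq_0_iff)
  qed
  ultimately show ?thesis
    using that by blast
qed

section \<open>Directions and lines\<close>

text \<open>Meaningful only for \<open>v \<noteq> 0\<close>: the span of 0 is no direction and its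
  abstraction is unspecified.\<close>

definition dir_of :: "real^2 \<Rightarrow> direction" where
  "dir_of v = Direction (span {v})"

lemma vectors_of_dir_of:
  assumes "v \<noteq> 0"
  shows "vectors_of (dir_of v) = span {v}"
  unfolding dir_of_def
  by (rule Direction_inverse) (use assms in \<open>simp add: dim_span dim_singleton\<close>)

lemma vectors_of_eq_span:
  assumes "v \<in> vectors_of d" "v \<noteq> 0"
  shows "vectors_of d = span {v}"
proof -
  have d: "subspace (vectors_of d)" "dim (vectors_of d) = 1"
    using vectors_of[of d] by auto
  have "span {v} \<subseteq> vectors_of d"
    using assms d by (intro span_minimal) auto
  then show ?thesis
    using subspace_dim_equal[of "span {v}" "vectors_of d"] d assms
    by (simp add: dim_span dim_singleton)
qed

lemma dir_of_eqI: "v \<in> vectors_of d \<Longrightarrow> v \<noteq> 0 \<Longrightarrow> dir_of v = d"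
  by (metis vectors_of_dir_of vectors_of_eq_span vectors_of_inject)

lemma direction_nonzero_vector:
  obtains v where "v \<in> vectors_of d" "v \<noteq> 0"
proof -
  have "dim (vectors_of d) = 1"
    using vectors_of[of d] by auto
  then have "\<not> vectors_of d \<subseteq> {0}"
    by (metis dim_eq_0 zero_neq_one)
  then show ?thesis
    using that by auto
qed

lemma parallel_vectors:
  assumes "u \<in> vectors_of d" "u \<noteq> 0" "v \<in> vectors_of d" "v \<noteq> 0"
  obtains t where "t \<noteq> 0" "v = t *\<^sub>R u"
proof -
  have "v \<in> span {u}"
    using assms vectors_of_eq_span by metis
  then obtain t where "v = t *\<^sub>R u"
    by (auto simp: span_singleton)
  then show ?thesis
    using that assms by force
qed

lemma Aff_in_affine_line [simp]: "Aff x \<in> affine_line a d \<longleftrightarrow> x - a \<in> vectors_of d"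
  unfolding affine_line_def by auto

lemma At_Inf_in_affine_line [simp]: "At_Inf e \<in> affine_line a d \<longleftrightarrow> e = d"
  unfolding affine_line_def by auto

lemma is_line_affine_line: "is_line (affine_line a d)"
  unfolding is_line_def by auto

lemma zero_in_vectors_of [simp]: "0 \<in> vectors_of d"
  using vectors_of[of d] by (auto intro: subspace_0)

lemma in_vectors_of_dir_of: "v \<noteq> 0 \<Longrightarrow> v \<in> vectors_of (dir_of v)"
  by (simp add: vectors_of_dir_of span_base)

lemma diff_in_vectors_of: "u \<in> vectors_of d \<Longrightarrow> v \<in> vectors_of d \<Longrightarrow> u - v \<in> vectors_of d"
  using vectors_of[of d] by (auto intro: subspace_diff)

lemma line_through_two_affine_points:
  assumes "is_line L" "Aff x \<in> L" "Aff y \<in> L" "x \<noteq> y"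
  shows "At_Inf (dir_of (y - x)) \<in> L"
    and "\<And>z. Aff z \<in> L \<Longrightarrow> z - x \<in> vectors_of (dir_of (y - x))"
proof -
  obtain a d where L: "L = affine_line a d"
    using assms unfolding is_line_def line_at_infinity_def by auto
  have par: "z - x \<in> vectors_of d" if "Aff z \<in> L" for z
    using diff_in_vectors_of[of "z - a" d "x - a"] that assms unfolding L by simp
  then have "dir_of (y - x) = d"
    using assms by (intro dir_of_eqI) auto
  then show "At_Inf (dir_of (y - x)) \<in> L" "\<And>z. Aff z \<in> L \<Longrightarrow> z - x \<in> vectors_of (dir_of (y - x))"
    using par unfolding L by auto
qed

lemma general_positionD:
  assumes "general_position P" "p \<in> P" "q \<in> P" "r \<in> P" "is_line L" "p \<in> L" "q \<in> L" "r \<in> L"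
  shows "p = q \<or> q = r \<or> p = r"
proof (rule ccontr)
  assume neq: "\<not> ?thesis"
  have "\<exists>L. is_line L \<and> {p, q, r} \<subseteq> L"
    using assms by (intro exI[of _ L]) simp
  then show False
    using assms(1-4) neq unfolding general_position_def by metis
qed

lemma general_position_affineD:
  assumes "general_position P" "Aff x \<in> P" "Aff y \<in> P" "Aff z \<in> P"
    and "y - x \<in> vectors_of d" "z - x \<in> vectors_of d"
  shows "x = y \<or> y = z \<or> x = z"
  using general_positionD[OF assms(1-4) is_line_affine_line[of x d]] assms(5,6) by simp

section \<open>Multiplicative parametrizations of conics\<close>

text \<open>The parameter \<open>\<phi>\<close> comes from the group structure on a conic: the direction of a chord determines
  the product of the parameters of its endpoints, and \<open>\<psi>\<close> is this function of the direction.\<close>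

definition chord_param :: "(real^2) set \<Rightarrow> (real^2 \<Rightarrow> complex) \<Rightarrow> (real^2 \<Rightarrow> complex) \<Rightarrow> bool" where
  "chord_param X \<phi> \<psi> \<longleftrightarrow> inj_on \<phi> X \<and> 0 \<notin> \<phi> ` X \<and> (\<forall>t v. t \<noteq> 0 \<longrightarrow> \<psi> (t *\<^sub>R v) = \<psi> v) \<and>
     (\<forall>x\<in>X. \<forall>y\<in>X. x \<noteq> y \<longrightarrow> \<psi> (x - y) = \<phi> x * \<phi> y)"

lemma chord_param_subset: "chord_param X \<phi> \<psi> \<Longrightarrow> Y \<subseteq> X \<Longrightarrow> chord_param Y \<phi> \<psi>"
  unfolding chord_param_def by (meson image_mono inj_on_subset subsetD)

lemma chord_param_parallel:
  assumes "chord_param X \<phi> \<psi>" "u \<in> vectors_of d" "u \<noteq> 0" "v \<in> vectors_of d" "v \<noteq> 0"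
  shows "\<psi> u = \<psi> v"
  using assms parallel_vectors[of u d v] unfolding chord_param_def by metis

text \<open>Parallel chords from \<open>x\<close> have equal products, and cancelling \<phi> x
  identifies their other endpoints. For a conic, this says that a line has at most two affine points
  on it.\<close>

lemma chord_param_not_collinear:
  assumes "chord_param X \<phi> \<psi>" "x \<in> X" "y \<in> X" "z \<in> X"
    and "y - x \<in> vectors_of d" "z - x \<in> vectors_of d"
  shows "x = y \<or> y = z \<or> x = z"
proof (rule ccontr)
  assume neq: "\<not> ?thesis"
  then have "\<psi> (y - x) = \<psi> (z - x)"
    using assms by (intro chord_param_parallel) auto
  then have "\<phi> y * \<phi> x = \<phi> z * \<phi> x"
    using assms neq unfolding chord_param_def by metis
  moreover have "\<phi> x \<noteq> 0"
    using assms unfolding chord_param_def by auto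
  ultimately have "y = z"
    using assms unfolding chord_param_def by (metis inj_onD mult_right_cancel)
  then show False
    using neq by simp
qed

lemma distinct_products_card_le_directions:
  assumes cp: "chord_param X \<phi> \<psi>" and "finite D"
    and D: "\<And>x y. x \<in> X \<Longrightarrow> y \<in> X \<Longrightarrow> x \<noteq> y \<Longrightarrow> dir_of (x - y) \<in> D"
  shows "card (distinct_products (\<phi> ` X)) \<le> card D"
proof -
  \<comment> \<open>A representative vector of each direction turns the scale-invariant \<psi> into
    a function of directions, whose image of \<open>D\<close> contains all products.\<close>
  define pick where "pick = (\<lambda>d. SOME v. v \<in> vectors_of d \<and> v \<noteq> 0)"
  have pick: "pick d \<in> vectors_of d" "pick d \<noteq> 0" for d
  proof -
    have "\<exists>v. v \<in> vectors_of d \<and> v \<noteq> 0"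
      using direction_nonzero_vector by metis
    from someI_ex[OF this] show "pick d \<in> vectors_of d" "pick d \<noteq> 0"
      unfolding pick_def by auto
  qed
  have "distinct_products (\<phi> ` X) \<subseteq> (\<lambda>d. \<psi> (pick d)) ` D"
  proof
    fix s assume "s \<in> distinct_products (\<phi> ` X)"
    then obtain x y where xy: "x \<in> X" "y \<in> X" "x \<noteq> y" "s = \<phi> x * \<phi> y"
      unfolding distinct_products_def by auto
    then have "s = \<psi> (x - y)"
      using cp unfolding chord_param_def by auto
    also have "\<dots> = \<psi> (pick (dir_of (x - y)))"
      using xy pick by (intro chord_param_parallel[OF cp]) (auto intro: in_vectors_of_dir_of)
    finally show "s \<in> (\<lambda>d. \<psi> (pick d)) ` D"
      using D[OF xy(1-3)] by auto
  qed
  then show ?thesis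
    by (metis assms(2) card_image_le card_mono finite_imageI order_trans)
qed

section \<open>Hyperbolas and parabolas\<close>

text \<open>In the coordinates of the two factors the curve is u v = K with parameter u. The chord
  between parameters u and u' has slope -K / (u u'), from which the product is recovered.\<close>

lemma chord_param_hyperbola:
  fixes L1 L2 :: "real^2 \<Rightarrow> real"
  assumes lin: "linear L1" "linear L2" and ker: "\<And>v. L1 v = 0 \<Longrightarrow> L2 v = 0 \<Longrightarrow> v = 0"
    and K: "K \<noteq> 0" and X: "\<And>x. x \<in> X \<Longrightarrow> (L1 x + c1) * (L2 x + c2) = K"
  shows "\<exists>\<phi> \<psi>. chord_param X \<phi> \<psi> \<and> \<phi> ` X \<subseteq> \<real>"
proof -
  define \<phi> where "\<phi> = (\<lambda>x. complex_of_real (L1 x + c1))"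
  define \<psi> where "\<psi> = (\<lambda>v. complex_of_real (- K * L1 v / L2 v))"
  have nz: "L1 x + c1 \<noteq> 0" if "x \<in> X" for x
    using X[OF that] K by auto
  have L1_neq: "L1 x \<noteq> L1 y" if "x \<in> X" "y \<in> X" "x \<noteq> y" for x y
  proof
    assume eq: "L1 x = L1 y"
    then have "L2 x = L2 y"
      using X[OF that(1)] X[OF that(2)] nz[OF that(1)] by (metis add_right_cancel mult_left_cancel)
    then show False
      using eq ker[of "x - y"] that lin by (simp add: linear_diff)
  qed
  have "chord_param X \<phi> \<psi>"
    unfolding chord_param_def
  proof (intro conjI ballI allI impI)
    show "inj_on \<phi> X"
      using L1_neq unfolding inj_on_def \<phi>_def by (metis add_right_cancel of_real_eq_iff)
    show "0 \<notin> \<phi> ` X"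
      unfolding \<phi>_def image_iff using nz by (metis of_real_eq_0_iff)
    show "\<psi> (t *\<^sub>R v) = \<psi> v" if "t \<noteq> 0" for t v
      using that lin by (simp add: \<psi>_def linear_cmul)
    show "\<psi> (x - y) = \<phi> x * \<phi> y" if xy: "x \<in> X" "y \<in> X" "x \<noteq> y" for x y
    proof -
      define u v where "u = L1 x + c1" and "v = L1 y + c1"
      have uv: "u \<noteq> 0" "v \<noteq> 0" "u \<noteq> v"
        using nz L1_neq xy unfolding u_def v_def by auto
      have "L2 x + c2 = K / u" "L2 y + c2 = K / v"
        using X[OF xy(1)] X[OF xy(2)] uv unfolding u_def v_def by (auto simp: field_simps)
      then have "L2 (x - y) = K / u - K / v"
        using lin by (simp add: linear_diff)
      also have "\<dots> = - K * (u - v) / (u * v)"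
        using uv by (simp add: field_simps)
      finally have L2: "L2 (x - y) = - K * (u - v) / (u * v)" .
      have L1: "L1 (x - y) = u - v"
        using lin by (simp add: linear_diff u_def v_def)
      have "- K * L1 (x - y) / L2 (x - y) = u * v"
        unfolding L1 L2 using uv K by (simp add: field_simps)
      then show ?thesis
        unfolding \<psi>_def \<phi>_def u_def v_def by (metis of_real_mult)
    qed
  qed
  moreover have "\<phi> ` X \<subseteq> \<real>"
    unfolding \<phi>_def by auto
  ultimately show ?thesis by blast
qed

text \<open>On v = u^2 - c the chord slope is the sum of the parameters; the exponential turns this
  additive group into a multiplicative one.\<close>

lemma chord_param_parabola:
  fixes L1 L2 :: "real^2 \<Rightarrow> real"
  assumes lin: "linear L1" "linear L2" and ker: "\<And>v. L1 v = 0 \<Longrightarrow> L2 v = 0 \<Longrightarrow> v = 0"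
    and X: "\<And>x. x \<in> X \<Longrightarrow> (L1 x)\<^sup>2 = L2 x + c"
  shows "\<exists>\<phi> \<psi>. chord_param X \<phi> \<psi> \<and> \<phi> ` X \<subseteq> \<real>"
proof -
  define \<phi> where "\<phi> = (\<lambda>x. complex_of_real (exp (L1 x)))"
  define \<psi> where "\<psi> = (\<lambda>v. complex_of_real (exp (L2 v / L1 v)))"
  have L1_neq: "L1 x \<noteq> L1 y" if "x \<in> X" "y \<in> X" "x \<noteq> y" for x y
  proof
    assume eq: "L1 x = L1 y"
    then have "L2 x = L2 y"
      using X[OF that(1)] X[OF that(2)] by simp
    then show False
      using eq ker[of "x - y"] that lin by (simp add: linear_diff)
  qed
  have "chord_param X \<phi> \<psi>"
    unfolding chord_param_def
  proof (intro conjI ballI allI impI)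
    show "inj_on \<phi> X"
      using L1_neq unfolding inj_on_def \<phi>_def by (metis exp_inj_iff of_real_eq_iff)
    show "0 \<notin> \<phi> ` X"
      unfolding \<phi>_def by auto
    show "\<psi> (t *\<^sub>R v) = \<psi> v" if "t \<noteq> 0" for t v
      using that lin by (simp add: \<psi>_def linear_cmul)
    show "\<psi> (x - y) = \<phi> x * \<phi> y" if xy: "x \<in> X" "y \<in> X" "x \<noteq> y" for x y
    proof -
      have "L2 (x - y) = (L1 x)\<^sup>2 - (L1 y)\<^sup>2"
        using X[OF xy(1)] X[OF xy(2)] lin by (simp add: linear_diff)
      also have "\<dots> = (L1 x + L1 y) * L1 (x - y)"
        using lin by (simp add: linear_diff power2_eq_square algebra_simps)
      finally have "L2 (x - y) / L1 (x - y) = L1 x + L1 y"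
        using L1_neq[OF xy] linear_diff[OF lin(1)] by simp
      then show ?thesis
        unfolding \<psi>_def \<phi>_def by (simp add: exp_add)
    qed
  qed
  moreover have "\<phi> ` X \<subseteq> \<real>"
    unfolding \<phi>_def by auto
  ultimately show ?thesis by blast
qed

section \<open>The unit circle in complex coordinates\<close>

definition to_complex :: "real^2 \<Rightarrow> complex" where
  "to_complex x = Complex (x $ 1) (x $ 2)"

lemma to_complex_simps [simp]:
  "to_complex (x + y) = to_complex x + to_complex y"
  "to_complex (x - y) = to_complex x - to_complex y"
  "to_complex (t *\<^sub>R x) = t *\<^sub>R to_complex x"
  unfolding to_complex_def by (auto simp: complex_eq_iff)

lemma to_complex_eq_iff [simp]: "to_complex x = to_complex y \<longleftrightarrow> x = y"
  unfolding to_complex_def by (auto simp: vec_eq_iff forall_2)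

lemma to_complex_vector [simp]: "to_complex (vector [a, b]) = Complex a b"
  unfolding to_complex_def by simp

lemma cnj_unit:
  assumes "cmod z = 1"
  shows "cnj z = 1 / z"
proof -
  have "z * cnj z = 1"
    using complex_norm_square[of z] assms by simp
  then show ?thesis
    by (metis mult_zero_left nonzero_mult_div_cancel_left zero_neq_one)
qed

text \<open>A nonzero number of argument \<theta> goes to -exp(2 i \<theta>): doubling the angle
  forgets length and orientation, and the sign makes the value the product of the endpoints of a
  chord.\<close>

definition chord_slope :: "complex \<Rightarrow> complex" where
  "chord_slope w = - (w / cnj w)"

text \<open>Conjugation inverts unit numbers, so cnj (p - q) = 1 / p - 1 / q = (q - p) / (p
  q).\<close>

lemma chord_slope_unit:
  assumes "cmod p = 1" "cmod q = 1" "p \<noteq> q"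
  shows "chord_slope (p - q) = p * q"
proof -
  define t where "t = q - p"
  have nz: "p \<noteq> 0" "q \<noteq> 0" "t \<noteq> 0"
    using assms unfolding t_def by auto
  have "cnj (p - q) = t / (p * q)"
    using assms nz unfolding t_def by (simp add: cnj_unit field_simps)
  moreover have "p - q = - t"
    unfolding t_def by simp
  ultimately show ?thesis
    unfolding chord_slope_def using nz by simp
qed

lemma chord_slope_scaleR: "t \<noteq> 0 \<Longrightarrow> chord_slope (t *\<^sub>R w) = chord_slope w"
  by (simp add: chord_slope_def scaleR_conv_of_real)

lemma chord_param_circle:
  assumes lin: "linear g" "inj g" and X: "\<And>x. x \<in> X \<Longrightarrow> cmod (to_complex (g x + b)) = 1"
  shows "chord_param X (\<lambda>x. to_complex (g x + b)) (\<lambda>v. chord_slope (to_complex (g v)))"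
  unfolding chord_param_def
proof (intro conjI ballI allI impI)
  show "inj_on (\<lambda>x. to_complex (g x + b)) X"
    using lin(2) by (auto simp: inj_on_def simp del: to_complex_simps)
  show "0 \<notin> (\<lambda>x. to_complex (g x + b)) ` X"
    using X by fastforce
  show "chord_slope (to_complex (g (t *\<^sub>R v))) = chord_slope (to_complex (g v))" if "t \<noteq> 0" for t v
    using that lin by (simp add: linear_cmul chord_slope_scaleR)
  show "chord_slope (to_complex (g (x - y))) = to_complex (g x + b) * to_complex (g y + b)"
    if xy: "x \<in> X" "y \<in> X" "x \<noteq> y" for x y
  proof -
    have "to_complex (g (x - y)) = to_complex (g x + b) - to_complex (g y + b)"
      using lin by (simp add: linear_diff)
    moreover have "to_complex (g x + b) \<noteq> to_complex (g y + b)"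
      using xy lin(2) by (simp add: inj_eq del: to_complex_simps)
    ultimately show ?thesis
      using chord_slope_unit X xy by metis
  qed
qed

section \<open>Normal forms of conics\<close>

lemma symmetric_matrix_nth:
  assumes "transpose M = M"
  shows "M $ i $ j = M $ j $ i"
proof -
  have "transpose M $ i $ j = M $ j $ i"
    by (simp add: transpose_def)
  then show ?thesis
    unfolding assms .
qed

lemma Aff_in_conic_iff:
  assumes "transpose M = M"
  shows "Aff x \<in> conic M \<longleftrightarrow>
    M $ 1 $ 1 * (x $ 1)\<^sup>2 + 2 * M $ 1 $ 2 * x $ 1 * x $ 2 + M $ 2 $ 2 * (x $ 2)\<^sup>2 +
    2 * M $ 1 $ 3 * x $ 1 + 2 * M $ 2 $ 3 * x $ 2 + M $ 3 $ 3 = 0"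
proof -
  have sym: "M $ 2 $ 1 = M $ 1 $ 2" "M $ 3 $ 1 = M $ 1 $ 3" "M $ 3 $ 2 = M $ 2 $ 3"
    by (rule symmetric_matrix_nth[OF assms])+
  show ?thesis
    unfolding conic_def homogeneous_def
    by (auto simp: inner_vec_def matrix_vector_mult_def sum_3 sym algebra_simps power2_eq_square)
qed

lemma det_symmetric_3:
  fixes M :: "real^3^3"
  assumes "transpose M = M"
  shows "det M = M $ 1 $ 1 * M $ 2 $ 2 * M $ 3 $ 3 + 2 * M $ 1 $ 2 * M $ 1 $ 3 * M $ 2 $ 3 -
    M $ 1 $ 1 * (M $ 2 $ 3)\<^sup>2 - M $ 2 $ 2 * (M $ 1 $ 3)\<^sup>2 - M $ 3 $ 3 * (M $ 1 $ 2)\<^sup>2"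
proof -
  have sym: "M $ 2 $ 1 = M $ 1 $ 2" "M $ 3 $ 1 = M $ 1 $ 3" "M $ 3 $ 2 = M $ 2 $ 3"
    by (rule symmetric_matrix_nth[OF assms])+
  show ?thesis
    unfolding det_3 sym by (simp add: power2_eq_square algebra_simps)
qed

lemma linear_form_2: "linear (\<lambda>x :: real^2. p * x $ 1 + q * x $ 2)"
  by (rule linearI) (auto simp: algebra_simps)

text \<open>Cramer's rule.\<close>

lemma linear_form_2_kernel:
  fixes v :: "real^2" and p q r s :: real
  assumes "p * v $ 1 + q * v $ 2 = 0" "r * v $ 1 + s * v $ 2 = 0" "p * s - q * r \<noteq> 0"
  shows "v = 0"
proof -
  have "(p * s - q * r) * v $ 1 = s * (p * v $ 1 + q * v $ 2) - q * (r * v $ 1 + s * v $ 2)"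
    "(p * s - q * r) * v $ 2 = p * (r * v $ 1 + s * v $ 2) - r * (p * v $ 1 + q * v $ 2)"
    by (simp_all add: algebra_simps)
  then have "(p * s - q * r) * v $ 1 = 0" "(p * s - q * r) * v $ 2 = 0"
    unfolding assms by simp_all
  then show ?thesis
    using assms(3) by (simp add: vec_eq_iff forall_2)
qed

text \<open>Completing the square gives a hyperbola for negative and a parabola for zero
  discriminant, each treated separately according to whether the coefficient of x^2 vanishes. The
  determinant of \<open>M\<close> keeps the normal form from degenerating.\<close>

lemma chord_param_not_ellipse:
  assumes sym: "transpose M = M" and det: "det M \<noteq> 0"
    and disc: "M $ 1 $ 1 * M $ 2 $ 2 - (M $ 1 $ 2)\<^sup>2 \<le> 0"
  shows "\<exists>\<phi> \<psi>. chord_param {x. Aff x \<in> conic M} \<phi> \<psi> \<and> \<phi> ` {x. Aff x \<in> conic M} \<subseteq> \<real>"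
proof -
  define a b c d e f where defs: "a = M $ 1 $ 1" "b = M $ 1 $ 2" "c = M $ 2 $ 2"
    "d = M $ 1 $ 3" "e = M $ 2 $ 3" "f = M $ 3 $ 3"
  have eq: "a * (x $ 1)\<^sup>2 + 2 * b * x $ 1 * x $ 2 + c * (x $ 2)\<^sup>2 + 2 * d * x $ 1 + 2 * e * x $ 2 + f = 0"
    if "x \<in> {x. Aff x \<in> conic M}" for x
    using that unfolding defs mem_Collect_eq Aff_in_conic_iff[OF sym] .
  have D: "a * c * f + 2 * b * d * e - a * e\<^sup>2 - c * d\<^sup>2 - f * b\<^sup>2 \<noteq> 0"
    using det unfolding det_symmetric_3[OF sym] defs .
  consider "a * c - b\<^sup>2 < 0" "a \<noteq> 0" | "a * c - b\<^sup>2 < 0" "a = 0"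
    | "a * c - b\<^sup>2 = 0" "a \<noteq> 0" | "a * c - b\<^sup>2 = 0" "a = 0"
    using disc unfolding defs by linarith
  then show ?thesis
  proof cases
    case 1
    \<comment> \<open>Multiplied by \<open>a\<close>, the equation reads u^2 - (s y - k)^2 = K with
      u = a x + b y + d, a difference of squares that factors. Here K s^2 is \<open>a\<close> times
      the determinant.\<close>
    define s where "s = sqrt (b\<^sup>2 - a * c)"
    have s: "s > 0" "s\<^sup>2 = b\<^sup>2 - a * c"
      unfolding s_def using 1 by auto
    define k where "k = (a * e - b * d) / s"
    have k: "k * s = a * e - b * d"
      unfolding k_def using s by simp
    define K where "K = d\<^sup>2 - k\<^sup>2 - a * f"
    have "K * s\<^sup>2 = (d\<^sup>2 - a * f) * s\<^sup>2 - (k * s)\<^sup>2"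
      unfolding K_def by (simp add: algebra_simps power_mult_distrib)
    also have "\<dots> = a * (a * c * f + 2 * b * d * e - a * e\<^sup>2 - c * d\<^sup>2 - f * b\<^sup>2)"
      unfolding k s by (simp add: algebra_simps power2_eq_square)
    finally have "K \<noteq> 0"
      using D 1 by auto
    show ?thesis
    proof (rule chord_param_hyperbola[OF linear_form_2 linear_form_2 _ \<open>K \<noteq> 0\<close>])
      show "v = 0" if "a * v $ 1 + (b - s) * v $ 2 = 0" "a * v $ 1 + (b + s) * v $ 2 = 0" for v :: "real^2"
        using linear_form_2_kernel[OF that] s 1 by (simp add: algebra_simps)
      fix x assume "x \<in> {x. Aff x \<in> conic M}"
      have "(a * x $ 1 + (b - s) * x $ 2 + (d + k)) * (a * x $ 1 + (b + s) * x $ 2 + (d - k)) - K =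
         (a * x $ 1 + b * x $ 2 + d)\<^sup>2 - s\<^sup>2 * (x $ 2)\<^sup>2 + 2 * (k * s) * x $ 2 - k\<^sup>2 - K"
        by (simp add: algebra_simps power2_eq_square)
      also have "\<dots> = a * (a * (x $ 1)\<^sup>2 + 2 * b * x $ 1 * x $ 2 + c * (x $ 2)\<^sup>2 + 2 * d * x $ 1 + 2 * e * x $ 2 + f)"
        unfolding k s K_def by (simp add: algebra_simps power2_eq_square)
      finally show "(a * x $ 1 + (b - s) * x $ 2 + (d + k)) * (a * x $ 1 + (b + s) * x $ 2 + (d - k)) = K"
        using eq[OF \<open>x \<in> _\<close>] by simp
    qed
  next
    case 2
    then have b: "b \<noteq> 0"
      by auto
    \<comment> \<open>Without an x^2 term the leading form is y (2 b x + c y). Shifting y by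
      \<open>h\<close> absorbs the linear terms, and K b^2 is the determinant.\<close>
    define h where "h = d / b"
    have d: "d = h * b"
      unfolding h_def using b by simp
    define K where "K = h * (2 * e - c * h) - f"
    have "K * b\<^sup>2 = a * c * f + 2 * b * d * e - a * e\<^sup>2 - c * d\<^sup>2 - f * b\<^sup>2"
      unfolding K_def d using 2 by (simp add: algebra_simps power2_eq_square)
    then have "K \<noteq> 0"
      using D by auto
    show ?thesis
    proof (rule chord_param_hyperbola[OF linear_form_2 linear_form_2 _ \<open>K \<noteq> 0\<close>])
      show "v = 0" if "0 * v $ 1 + 1 * v $ 2 = 0" "(2 * b) * v $ 1 + c * v $ 2 = 0" for v :: "real^2"
        using linear_form_2_kernel[OF that] b by simp
      fix x assume "x \<in> {x. Aff x \<in> conic M}"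
      from eq[OF this]
      show "(0 * x $ 1 + 1 * x $ 2 + h) * (2 * b * x $ 1 + c * x $ 2 + (2 * e - c * h)) = K"
        unfolding K_def d using 2 by (simp add: algebra_simps power2_eq_square)
    qed
  next
    case 3
    \<comment> \<open>At zero discriminant the right side is -a times the determinant; the left side
      must not vanish for the two linear forms of the parabola to be independent.\<close>
    have "(a * e - b * d)\<^sup>2 = (a * c - b\<^sup>2) * (a * f - d\<^sup>2)
        - a * (a * c * f + 2 * b * d * e - a * e\<^sup>2 - c * d\<^sup>2 - f * b\<^sup>2)"
      by (simp add: algebra_simps power2_eq_square)
    then have ne: "a * e - b * d \<noteq> 0"
      using 3 D by auto
    show ?thesis
    proof (rule chord_param_parabola[OF linear_form_2 linear_form_2])
      show "v = 0" if "a * v $ 1 + b * v $ 2 = 0" "(- (2 * a * d)) * v $ 1 + (- (2 * a * e)) * v $ 2 = 0"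
        for v :: "real^2"
      proof (rule linear_form_2_kernel[OF that])
        have "a * - (2 * a * e) - b * - (2 * a * d) = - 2 * a * (a * e - b * d)"
          by (simp add: algebra_simps)
        then show "a * - (2 * a * e) - b * - (2 * a * d) \<noteq> 0"
          using ne 3 by simp
      qed
      fix x assume "x \<in> {x. Aff x \<in> conic M}"
      have "(a * x $ 1 + b * x $ 2)\<^sup>2 - (- (2 * a * d) * x $ 1 + - (2 * a * e) * x $ 2 + - (a * f)) =
        a * (a * (x $ 1)\<^sup>2 + 2 * b * x $ 1 * x $ 2 + c * (x $ 2)\<^sup>2 + 2 * d * x $ 1 + 2 * e * x $ 2 + f)
        - (a * c - b\<^sup>2) * (x $ 2)\<^sup>2"
        by (simp add: algebra_simps power2_eq_square)
      then show "(a * x $ 1 + b * x $ 2)\<^sup>2 = - (2 * a * d) * x $ 1 + - (2 * a * e) * x $ 2 + - (a * f)"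
        using eq[OF \<open>x \<in> _\<close>] 3 by simp
    qed
  next
    case 4
    \<comment> \<open>The determinant reduces to -c d^2, and case 3 repeats with x and y
      exchanged.\<close>
    then have b: "b = 0" and cd: "c * d \<noteq> 0"
      using D by auto
    show ?thesis
    proof (rule chord_param_parabola[OF linear_form_2 linear_form_2])
      show "v = 0" if "0 * v $ 1 + c * v $ 2 = 0" "(- (2 * c * d)) * v $ 1 + (- (2 * c * e)) * v $ 2 = 0"
        for v :: "real^2"
        using linear_form_2_kernel[OF that] cd by simp
      fix x assume "x \<in> {x. Aff x \<in> conic M}"
      have "(0 * x $ 1 + c * x $ 2)\<^sup>2 - (- (2 * c * d) * x $ 1 + - (2 * c * e) * x $ 2 + - (c * f)) =
        c * (a * (x $ 1)\<^sup>2 + 2 * b * x $ 1 * x $ 2 + c * (x $ 2)\<^sup>2 + 2 * d * x $ 1 + 2 * e * x $ 2 + f)"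
        unfolding 4(2) b by (simp add: algebra_simps power2_eq_square)
      then show "(0 * x $ 1 + c * x $ 2)\<^sup>2 = - (2 * c * d) * x $ 1 + - (2 * c * e) * x $ 2 + - (c * f)"
        using eq[OF \<open>x \<in> _\<close>] by simp
    qed
  qed
qed

text \<open>\<open>a\<close> times the equation is u^2 + (s y + k)^2 = K with u = a x + b y + d. The
  determinant gives K \<noteq> 0, the point \<open>x0\<close> makes K a sum of squares, and division
  by sqrt K lands on the unit circle.\<close>

lemma ellipse_normal_form:
  assumes sym: "transpose M = M" and det: "det M \<noteq> 0"
    and disc: "M $ 1 $ 1 * M $ 2 $ 2 - (M $ 1 $ 2)\<^sup>2 > 0" and ne: "Aff x0 \<in> conic M"
  shows "\<exists>g b. linear g \<and> inj g \<and> (\<forall>x. Aff x \<in> conic M \<longrightarrow> cmod (to_complex (g x + b)) = 1)"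
proof -
  define a b c d e f where defs: "a = M $ 1 $ 1" "b = M $ 1 $ 2" "c = M $ 2 $ 2"
    "d = M $ 1 $ 3" "e = M $ 2 $ 3" "f = M $ 3 $ 3"
  have eq: "a * (x $ 1)\<^sup>2 + 2 * b * x $ 1 * x $ 2 + c * (x $ 2)\<^sup>2 + 2 * d * x $ 1 + 2 * e * x $ 2 + f = 0"
    if "Aff x \<in> conic M" for x
    using that unfolding defs Aff_in_conic_iff[OF sym] .
  have D: "a * c * f + 2 * b * d * e - a * e\<^sup>2 - c * d\<^sup>2 - f * b\<^sup>2 \<noteq> 0"
    using det unfolding det_symmetric_3[OF sym] defs .
  have ac: "a * c - b\<^sup>2 > 0"
    using disc unfolding defs .
  then have a: "a \<noteq> 0"
    by auto
  define s where "s = sqrt (a * c - b\<^sup>2)"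
  have s: "s > 0" "s\<^sup>2 = a * c - b\<^sup>2"
    unfolding s_def using ac by auto
  define k where "k = (a * e - b * d) / s"
  have k: "k * s = a * e - b * d"
    unfolding k_def using s by simp
  define K where "K = d\<^sup>2 + k\<^sup>2 - a * f"
  have "K * s\<^sup>2 = (d\<^sup>2 - a * f) * s\<^sup>2 + (k * s)\<^sup>2"
    unfolding K_def by (simp add: algebra_simps power_mult_distrib)
  also have "\<dots> = - a * (a * c * f + 2 * b * d * e - a * e\<^sup>2 - c * d\<^sup>2 - f * b\<^sup>2)"
    unfolding k s by (simp add: algebra_simps power2_eq_square)
  finally have K0: "K \<noteq> 0"
    using D a by auto
  have norm_form: "(a * x $ 1 + b * x $ 2 + d)\<^sup>2 + (s * x $ 2 + k)\<^sup>2 = K" if "Aff x \<in> conic M" for x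
  proof -
    have "(a * x $ 1 + b * x $ 2 + d)\<^sup>2 + (s * x $ 2 + k)\<^sup>2 - K =
        (a * x $ 1 + b * x $ 2 + d)\<^sup>2 + s\<^sup>2 * (x $ 2)\<^sup>2 + 2 * (k * s) * x $ 2 + k\<^sup>2 - K"
      by (simp add: algebra_simps power2_eq_square)
    also have "\<dots> = a * (a * (x $ 1)\<^sup>2 + 2 * b * x $ 1 * x $ 2 + c * (x $ 2)\<^sup>2 + 2 * d * x $ 1 + 2 * e * x $ 2 + f)"
      unfolding k s K_def by (simp add: algebra_simps power2_eq_square)
    finally show ?thesis
      using eq[OF that] by simp
  qed
  have K: "K > 0"
    using norm_form[OF ne] K0 by (metis add_nonneg_nonneg order_le_less zero_le_power2)
  define r where "r = sqrt K"
  have r: "r > 0" "r\<^sup>2 = K"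
    unfolding r_def using K by auto
  define g where "g = (\<lambda>x :: real^2. vector [(a / r) * x $ 1 + (b / r) * x $ 2, (s / r) * x $ 2] :: real^2)"
  have "linear g"
    unfolding g_def by (rule linearI) (auto simp: vec_eq_iff forall_2 algebra_simps add_divide_distrib)
  moreover have "inj g"
    using \<open>linear g\<close>
  proof (rule linear_injective_0[THEN iffD2], intro allI impI)
    fix x assume "g x = 0"
    then have "(a / r) * x $ 1 + (b / r) * x $ 2 = 0" "(s / r) * x $ 2 = 0"
      unfolding g_def by (auto simp: vec_eq_iff forall_2)
    then show "x = 0"
      using a s r by (auto simp: vec_eq_iff forall_2)
  qed
  moreover have "cmod (to_complex (g x + vector [d / r, k / r])) = 1" if "Aff x \<in> conic M" for x
  proof -
    have "to_complex (g x + vector [d / r, k / r]) =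
        Complex ((a * x $ 1 + b * x $ 2 + d) / r) ((s * x $ 2 + k) / r)"
      unfolding g_def to_complex_def by (simp add: add_divide_distrib)
    moreover have "((a * x $ 1 + b * x $ 2 + d) / r)\<^sup>2 + ((s * x $ 2 + k) / r)\<^sup>2 = 1"
      using norm_form[OF that] K0 r unfolding power_divide r(2) add_divide_distrib[symmetric] by simp
    ultimately show ?thesis
      by (simp add: cmod_def)
  qed
  ultimately show ?thesis by blast
qed

section \<open>Few directions\<close>

text \<open>A blocker in the affine plane would be a third affine point of \<open>Q\<close> on the
  line, distinct from \<open>x\<close> and \<open>y\<close> because \<open>R\<close> avoids
  \<open>P\<close>.\<close>

lemma blocking_direction:
  assumes cp: "chord_param {x. Aff x \<in> Q} \<phi> \<psi>"
    and PR: "P \<union> R \<subseteq> Q \<union> line_at_infinity" "R \<inter> P = {}" "blocks_lines R P"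
    and xy: "Aff x \<in> P" "Aff y \<in> P" "x \<noteq> y"
  shows "At_Inf (dir_of (x - y)) \<in> R"
proof -
  let ?d = "dir_of (x - y)"
  have par: "x - y \<in> vectors_of ?d"
    using xy by (intro in_vectors_of_dir_of) simp
  have L: "is_line (affine_line y ?d)" "Aff x \<in> affine_line y ?d" "Aff y \<in> affine_line y ?d"
    using par is_line_affine_line by simp_all
  have "Aff x \<noteq> Aff y"
    using xy by simp
  then obtain r where r: "r \<in> R" "r \<in> affine_line y ?d"
    using PR(3) xy(1,2) L unfolding blocks_lines_def by metis
  show ?thesis
  proof (cases r)
    case (At_Inf e)
    then show ?thesis
      using r by simp
  next
    case (Aff z)
    have Q: "Aff u \<in> Q" if "Aff u \<in> P \<union> R" for u
      using that PR(1) unfolding line_at_infinity_def by auto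
    have "y = x \<or> x = z \<or> y = z"
      by (rule chord_param_not_collinear[OF cp, of y x z ?d]) (use par r Aff xy Q in auto)
    then show ?thesis
      using r PR(2) xy Aff by auto
  qed
qed

text \<open>If \<open>At_Inf d\<close> is in \<open>P\<close>, the affine points of \<open>P\<close>
  lie on distinct lines of direction \<open>d\<close>, each needing its own affine blocker since its
  only point at infinity is in \<open>P\<close>. Chords from one point \<open>x0\<close> use up
  \<open>card A - 1\<close> points of \<open>R\<close> at infinity. With \<open>card A\<close> at
  least n - 2, where n is \<open>card P\<close>, this gives 2 n - 5 \<le> |R| < 3 n / 2, false for n
  > 10.\<close>

lemma no_points_at_infinity:
  assumes cp: "chord_param {x. Aff x \<in> Q} \<phi> \<psi>"
    and PR: "P \<union> R \<subseteq> Q \<union> line_at_infinity" "R \<inter> P = {}" "blocks_lines R P"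
    and gp: "general_position P" and fin: "finite R"
    and small: "2 * card R < 3 * card P" and large: "card P > 10"
  shows "P \<inter> line_at_infinity = {}"
proof (rule ccontr)
  assume "\<not> ?thesis"
  then obtain d where d: "At_Inf d \<in> P"
    unfolding line_at_infinity_def by auto
  define A where "A = {x. Aff x \<in> P}"
  have finP: "finite P"
    using large card.infinite by fastforce
  have "finite A"
    unfolding A_def using finP by (rule finite_inverse_image) (auto simp: inj_on_def)
  have P: "P = Aff ` A \<union> (P \<inter> line_at_infinity)"
  proof -
    have "p \<in> Aff ` A \<or> p \<in> line_at_infinity" if "p \<in> P" for p
      using that unfolding A_def line_at_infinity_def by (cases p) auto
    then show ?thesis
      unfolding A_def by auto
  qed
  have "card (P \<inter> line_at_infinity) \<le> 2"
  proof (rule ccontr)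
    assume "\<not> ?thesis"
    then have "3 \<le> card (P \<inter> line_at_infinity)"
      by simp
    then obtain T where T: "T \<subseteq> P \<inter> line_at_infinity" "card T = 3"
      by (metis obtain_subset_with_card_n)
    then obtain p q r where "T = {p, q, r}" and neq: "p \<noteq> q" "q \<noteq> r" "p \<noteq> r"
      using card_3_iff[of T] by blast
    then have "p \<in> P \<inter> line_at_infinity" "q \<in> P \<inter> line_at_infinity" "r \<in> P \<inter> line_at_infinity"
      using T by auto
    moreover have "is_line line_at_infinity"
      unfolding is_line_def by simp
    ultimately show False
      using general_positionD[OF gp] neq by blast
  qed
  moreover have "card P \<le> card (Aff ` A) + card (P \<inter> line_at_infinity)"
    by (subst P) (rule card_Un_le)
  moreover have "card (Aff ` A) = card A"
    by (rule card_image) (auto simp: inj_on_def)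
  ultimately have cardA: "card P \<le> card A + 2"
    by linarith
  have "\<exists>y. Aff y \<in> R \<and> y - x \<in> vectors_of d" if x: "x \<in> A" for x
  proof -
    have "is_line (affine_line x d)" "Aff x \<in> affine_line x d" "At_Inf d \<in> affine_line x d"
      using is_line_affine_line by simp_all
    moreover have "Aff x \<noteq> At_Inf d" "Aff x \<in> P"
      using x unfolding A_def by simp_all
    ultimately obtain r where r: "r \<in> R" "r \<in> affine_line x d"
      using PR(3) d unfolding blocks_lines_def by metis
    show ?thesis
      using r d PR(2) by (cases r) auto
  qed
  then obtain h where h: "\<And>x. x \<in> A \<Longrightarrow> Aff (h x) \<in> R" "\<And>x. x \<in> A \<Longrightarrow> h x - x \<in> vectors_of d"
    by metis
  have "inj_on (\<lambda>x. Aff (h x)) A"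
  proof (rule inj_onI, rule ccontr)
    fix x y assume xy: "x \<in> A" "y \<in> A" "Aff (h x) = Aff (h y)" "x \<noteq> y"
    have "y - x \<in> vectors_of d"
      using diff_in_vectors_of[OF h(2)[OF xy(1)] h(2)[OF xy(2)]] xy(3) by simp
    then show False
      using general_positionD[OF gp _ _ d is_line_affine_line[of x d], of "Aff x" "Aff y"] xy
      unfolding A_def by simp
  qed
  then have card1: "card A = card ((\<lambda>x. Aff (h x)) ` A)"
    by (simp add: card_image)
  have "A \<noteq> {}"
    using cardA large by auto
  then obtain x0 where x0: "x0 \<in> A"
    by auto
  have "inj_on (\<lambda>x. At_Inf (dir_of (x - x0))) (A - {x0})"
  proof (rule inj_onI)
    fix x y assume xy: "x \<in> A - {x0}" "y \<in> A - {x0}"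
      and "At_Inf (dir_of (x - x0)) = At_Inf (dir_of (y - x0))"
    then have eq: "dir_of (x - x0) = dir_of (y - x0)"
      by simp
    have "x - x0 \<in> vectors_of (dir_of (y - x0))" "y - x0 \<in> vectors_of (dir_of (y - x0))"
      using xy in_vectors_of_dir_of[of "x - x0"] in_vectors_of_dir_of[of "y - x0"] unfolding eq by auto
    then have "x0 = x \<or> x = y \<or> x0 = y"
      using xy x0 unfolding A_def by (intro general_position_affineD[OF gp]) auto
    then show "x = y"
      using xy by auto
  qed
  then have card2: "card A - 1 = card ((\<lambda>x. At_Inf (dir_of (x - x0))) ` (A - {x0}))"
    using x0 by (simp add: card_image)
  have "(\<lambda>x. At_Inf (dir_of (x - x0))) ` (A - {x0}) \<subseteq> R"
    using blocking_direction[OF cp PR] x0 unfolding A_def by auto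
  moreover have "(\<lambda>x. Aff (h x)) ` A \<subseteq> R"
    using h(1) by auto
  moreover have "(\<lambda>x. At_Inf (dir_of (x - x0))) ` (A - {x0}) \<inter> (\<lambda>x. Aff (h x)) ` A = {}"
    by auto
  ultimately have "card A - 1 + card A \<le> card R"
    using card_Int_lower[OF fin] unfolding card1[symmetric] card2[symmetric]
    by (metis add_0_right card.empty card1 card2)
  then show False
    using cardA small large by linarith
qed

text \<open>All chord directions lie in \<open>R\<close>, so the product set of the parameters has
  at most |R| < 3 n / 2 elements and the group argument applies.\<close>

lemma few_directions_roots_of_unity:
  assumes cp: "chord_param {x. Aff x \<in> Q} \<phi> \<psi>"
    and PR: "P \<union> R \<subseteq> Q \<union> line_at_infinity" "R \<inter> P = {}" "blocks_lines R P"
    and gp: "general_position P" and fin: "finite R"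
    and small: "2 * card R < 3 * card P" and large: "card P > 20"
  obtains A m where "P = Aff ` A" "card A = card P" "P \<subseteq> Q" "card P \<le> m" "m \<le> card R"
    and "\<forall>x\<in>A. \<forall>y\<in>A. (\<phi> x / \<phi> y) ^ m = 1" "card (\<phi> ` A) = card P"
proof -
  define A where "A = {x. Aff x \<in> P}"
  have none: "P \<inter> line_at_infinity = {}"
    by (rule no_points_at_infinity[OF cp PR gp fin small]) (use large in simp)
  then have PQ: "P \<subseteq> Q"
    using PR(1) by auto
  have P: "P = Aff ` A"
  proof -
    have "p \<in> Aff ` A" if "p \<in> P" for p
      using that none unfolding A_def line_at_infinity_def by (cases p) auto
    then show ?thesis
      unfolding A_def by auto
  qed
  have cardA: "card A = card P"
    unfolding P by (rule card_image[symmetric]) (auto simp: inj_on_def)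
  have finA: "finite A"
    using cardA large by (metis card.infinite not_less_zero)
  have AQ: "A \<subseteq> {x. Aff x \<in> Q}"
    using PQ unfolding A_def by auto
  have cpA: "chord_param A \<phi> \<psi>"
    by (rule chord_param_subset[OF cp AQ])
  have card\<phi>: "card (\<phi> ` A) = card P"
    using cpA unfolding chord_param_def by (simp add: card_image cardA)
  define D where "D = {d. At_Inf d \<in> R}"
  have finD: "finite D"
    unfolding D_def using fin by (rule finite_inverse_image) (auto simp: inj_on_def)
  have "card D = card (At_Inf ` D)"
    by (rule card_image[symmetric]) (auto simp: inj_on_def)
  also have "\<dots> \<le> card R"
    by (rule card_mono[OF fin]) (auto simp: D_def)
  finally have cardD: "card D \<le> card R" .
  have "card (distinct_products (\<phi> ` A)) \<le> card D"
    using blocking_direction[OF cp PR]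
    by (intro distinct_products_card_le_directions[OF cpA finD]) (auto simp: A_def D_def)
  then have le: "card (distinct_products (\<phi> ` A)) \<le> card R"
    using cardD by linarith
  have "2 * card (distinct_products (\<phi> ` A)) < 3 * card (\<phi> ` A)"
    using le small card\<phi> by linarith
  then obtain m where m: "card (\<phi> ` A) \<le> m" "m \<le> card (distinct_products (\<phi> ` A))"
      "\<And>x y. x \<in> \<phi> ` A \<Longrightarrow> y \<in> \<phi> ` A \<Longrightarrow> (x / y) ^ m = 1"
    using small_distinct_products_roots_of_unity[of "\<phi> ` A"] finA cpA card\<phi> large
    unfolding chord_param_def by (metis finite_imageI)
  show ?thesis
    by (rule that[OF P cardA PQ, of m]) (use m le card\<phi> in auto)
qed

text \<open>The group on a hyperbola or a parabola embeds in the multiplicative group of the reals, whose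
  finite subgroups have order at most two; only the circle group admits small product sets.\<close>

lemma few_directions_polygon:
  assumes quad: "is_quadric Q"
    and PR: "P \<union> R \<subseteq> Q \<union> line_at_infinity" "R \<inter> P = {}" "blocks_lines R P"
    and gp: "general_position P" and fin: "finite R"
    and small: "2 * card R < 3 * card P" and large: "card P > 20"
  shows "is_ellipse Q \<and> P \<subseteq> Q \<and>
    (\<exists>m X V f. m \<le> card R \<and> P = Aff ` X \<and> affine_map f \<and> bij f \<and>
       regular_polygon_vertices m V \<and> f ` X \<subseteq> V)"
proof -
  obtain M where M: "nondegenerate_real_conic M" "Q = conic M"
    using quad unfolding is_quadric_def by auto
  have sym: "transpose M = M" and det: "det M \<noteq> 0"
    using M unfolding nondegenerate_real_conic_def by auto
  have disc: "M $ 1 $ 1 * M $ 2 $ 2 - (M $ 1 $ 2)\<^sup>2 > 0"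
  proof (rule ccontr)
    assume "\<not> ?thesis"
    then obtain \<phi> \<psi> where cp: "chord_param {x. Aff x \<in> Q} \<phi> \<psi>" and real: "\<phi> ` {x. Aff x \<in> Q} \<subseteq> \<real>"
      using chord_param_not_ellipse[OF sym det] unfolding M(2) by auto
    obtain A m where A: "P = Aff ` A" "card A = card P" "P \<subseteq> Q" "card P \<le> m" "m \<le> card R"
      and root: "\<forall>x\<in>A. \<forall>y\<in>A. (\<phi> x / \<phi> y) ^ m = 1" and card\<phi>: "card (\<phi> ` A) = card P"
      by (rule few_directions_roots_of_unity[OF cp PR gp fin small large])
    have m: "m > 0"
      using A large by linarith
    obtain y where y: "y \<in> A"
      using A large by (metis all_not_in_conv card.empty not_less_zero)
    \<comment> \<open>Since 0 / 0 = 0, a vanishing parameter would give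
      \<open>0 ^ m = 1\<close>.\<close>
    have nz: "\<phi> y \<noteq> 0"
      using root[rule_format, OF y y] m by (auto simp: power_0_left)
    have "\<phi> ` A \<subseteq> {\<phi> y, - \<phi> y}"
    proof
      fix z assume "z \<in> \<phi> ` A"
      then obtain x where x: "x \<in> A" "z = \<phi> x"
        by auto
      have xy: "\<phi> x \<in> \<real>" "\<phi> y \<in> \<real>"
        using real x y A by auto
      then obtain r where r: "\<phi> x / \<phi> y = complex_of_real r"
        by (metis Reals_cases Reals_divide)
      have "r ^ m = 1"
        using root[rule_format, OF x(1) y] unfolding r by (metis of_real_eq_1_iff of_real_power)
      then have "\<bar>r\<bar> ^ m = 1 ^ m"
        by (simp add: power_abs[symmetric])
      then have "\<bar>r\<bar> = 1"
        using m by (subst (asm) power_eq_iff_eq_base) auto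
      then have "\<phi> x / \<phi> y = 1 \<or> \<phi> x / \<phi> y = - 1"
        unfolding r by (auto simp: abs_if split: if_splits)
      then show "z \<in> {\<phi> y, - \<phi> y}"
        using x nz by (auto simp: divide_eq_eq)
    qed
    then have "card (\<phi> ` A) \<le> card {\<phi> y, - \<phi> y}"
      by (rule card_mono[rotated]) simp
    also have "\<dots> \<le> 2"
      by (simp add: card_insert_if)
    finally show False
      using card\<phi> large by linarith
  qed
  have ell: "is_ellipse Q"
    using M disc unfolding is_ellipse_def by auto
  have "\<exists>x. Aff x \<in> Q"
  proof (rule ccontr)
    assume *: "\<nexists>x. Aff x \<in> Q"
    \<comment> \<open>A conic without affine points is parametrized vacuously, which would make
      \<open>P\<close> empty. The point found here fixes the sign in
      \<open>ellipse_normal_form\<close>.\<close>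
    then have "chord_param {x. Aff x \<in> Q} (\<lambda>_. 0) (\<lambda>_. 0)"
      unfolding chord_param_def by auto
    then obtain A where "P = Aff ` A" "P \<subseteq> Q"
      using few_directions_roots_of_unity[OF _ PR gp fin small large] by metis
    then show False
      using * large by (metis all_not_in_conv card.empty image_eqI not_less_zero subset_iff image_iff)
  qed
  then obtain g b where g: "linear g" "inj g"
    and unit: "\<And>x. Aff x \<in> Q \<Longrightarrow> cmod (to_complex (g x + b)) = 1"
    using ellipse_normal_form[OF sym det disc] unfolding M(2) by blast
  let ?\<phi> = "\<lambda>x. to_complex (g x + b)"
  have cp: "chord_param {x. Aff x \<in> Q} ?\<phi> (\<lambda>v. chord_slope (to_complex (g v)))"
    using unit by (intro chord_param_circle[OF g]) auto
  obtain A m where A: "P = Aff ` A" "card A = card P" "P \<subseteq> Q" "card P \<le> m" "m \<le> card R"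
    and root: "\<forall>x\<in>A. \<forall>y\<in>A. (?\<phi> x / ?\<phi> y) ^ m = 1"
    by (rule few_directions_roots_of_unity[OF cp PR gp fin small large])
  have m: "m > 0"
    using A large by linarith
  obtain y where y: "y \<in> A"
    using A large by (metis all_not_in_conv card.empty not_less_zero)
  \<comment> \<open>The polygon is rotated to have a vertex at the image of \<open>y\<close>; the
    other images differ from it by \<open>m\<close>-th roots of unity.\<close>
  define t where "t = Arg (?\<phi> y)"
  have "cmod (?\<phi> y) = 1"
    using unit y A by auto
  then have t: "?\<phi> y = cis t"
    unfolding t_def using rcis_cmod_Arg[of "?\<phi> y"] by (simp add: rcis_def del: to_complex_simps)
  define V where "V = (\<lambda>k. 0 + 1 *\<^sub>R vector [cos (t + 2 * pi * real k / real m),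
      sin (t + 2 * pi * real k / real m)] :: real^2) ` {..<m}"
  have "regular_polygon_vertices m V"
    unfolding regular_polygon_vertices_def V_def
    using A large by (intro conjI exI[of _ 0] exI[of _ 1] exI[of _ t]) auto
  moreover have "(\<lambda>x. g x + b) ` A \<subseteq> V"
  proof
    fix v assume "v \<in> (\<lambda>x. g x + b) ` A"
    then obtain x where x: "x \<in> A" "v = g x + b"
      by auto
    have "?\<phi> x / ?\<phi> y \<in> {z. z ^ m = 1}"
      using root[rule_format, OF x(1) y] by simp
    then obtain k where k: "k < m" "?\<phi> x / ?\<phi> y = cis (2 * pi * real k / real m)"
      using Complex.bij_betw_roots_unity[OF m] unfolding bij_betw_def by auto
    then have "to_complex v = cis t * cis (2 * pi * real k / real m)"
      unfolding x(2) t by (simp add: field_simps del: to_complex_simps)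
    also have "\<dots> = to_complex (vector [cos (t + 2 * pi * real k / real m),
        sin (t + 2 * pi * real k / real m)])"
      unfolding cis_mult by (simp add: complex_eq_iff)
    finally show "v \<in> V"
      using k(1) unfolding V_def by (simp del: to_complex_vector)
  qed
  moreover have "affine_map (\<lambda>x. g x + b)"
    unfolding affine_map_def using g by blast
  moreover have "bij (\<lambda>x. g x + b)"
  proof -
    have "surj g"
      using g by (rule linear_inj_imp_surj)
    then have "bij ((\<lambda>y. y + b) \<circ> g)"
      using g by (intro bij_comp) (auto simp: bij_def intro: surjI[of _ "\<lambda>y. y - b"])
    then show ?thesis
      by (simp add: o_def)
  qed
  ultimately show ?thesis
    using ell A by blast
qed

section \<open>Two cosets of the roots of unity\<close>

definition of_complex :: "complex \<Rightarrow> real^2" where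
  "of_complex z = vector [Re z, Im z]"

lemma to_complex_of_complex [simp]: "to_complex (of_complex z) = z"
  unfolding of_complex_def by simp

lemma norm_to_complex: "cmod (to_complex x) = norm x"
  by (simp add: to_complex_def cmod_def norm_vec_def L2_set_def sum_2)

lemma to_complex_eq_0_iff [simp]: "to_complex x = 0 \<longleftrightarrow> x = 0"
  by (metis norm_eq_zero norm_to_complex)

text \<open>Equal values make the quotient of the two numbers self-conjugate, hence real, so the
  vectors are parallel.\<close>

lemma dir_of_eq_if_chord_slope_eq:
  assumes nz: "u \<noteq> 0" "v \<noteq> 0" and eq: "chord_slope (to_complex u) = chord_slope (to_complex v)"
  shows "dir_of u = dir_of v"
proof -
  define x y where "x = to_complex u" and "y = to_complex v"
  have xy: "x \<noteq> 0" "y \<noteq> 0"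
    using nz unfolding x_def y_def by simp_all
  have "x / cnj x = y / cnj y"
    using eq unfolding chord_slope_def x_def y_def by simp
  then have "cnj (x / y) = x / y"
    using xy by (simp add: field_simps)
  then have "x / y \<in> \<real>"
    by (simp add: Reals_cnj_iff)
  then obtain r where "x / y = of_real r"
    by (auto elim: Reals_cases)
  then have "x = r *\<^sub>R y"
    using xy by (simp add: field_simps scaleR_conv_of_real)
  then have "u = r *\<^sub>R v"
    unfolding x_def y_def by (metis to_complex_eq_iff to_complex_simps(3))
  then have "u \<in> vectors_of (dir_of v)"
    using nz by (simp add: vectors_of_dir_of span_mul span_base)
  then show ?thesis
    using nz by (intro dir_of_eqI) auto
qed

text \<open>Inverse of \<open>chord_slope\<close> on unit numbers: a unit vector v has chord slope
  -v^2, and both square roots of -w span the same line.\<close>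

definition dir_of_slope :: "complex \<Rightarrow> direction" where
  "dir_of_slope w = dir_of (of_complex (csqrt (- w)))"

lemma chord_slope_csqrt:
  assumes "cmod w = 1"
  shows "chord_slope (csqrt (- w)) = w"
proof -
  have "cmod (csqrt (- w)) = 1"
    using assms by (simp add: norm_csqrt)
  then have "chord_slope (csqrt (- w)) = - (csqrt (- w))\<^sup>2"
    by (simp add: chord_slope_def cnj_unit power2_eq_square)
  then show ?thesis by simp
qed

lemma dir_of_eq_dir_of_slope:
  assumes "v \<noteq> 0" "cmod (chord_slope (to_complex v)) = 1"
  shows "dir_of v = dir_of_slope (chord_slope (to_complex v))"
proof -
  let ?w = "chord_slope (to_complex v)"
  have "?w \<noteq> 0"
    using assms by auto
  then have "of_complex (csqrt (- ?w)) \<noteq> 0"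
    by (simp flip: to_complex_eq_0_iff)
  then show ?thesis
    unfolding dir_of_slope_def using assms
    by (intro dir_of_eq_if_chord_slope_eq) (simp_all add: chord_slope_csqrt)
qed

lemma chord_param_unit_circle:
  "chord_param {x. cmod (to_complex x) = 1} to_complex (\<lambda>v. chord_slope (to_complex v))"
  using chord_param_circle[of "\<lambda>x. x" "{x. cmod (to_complex x) = 1}" 0]
  by (simp add: linear_ident)

lemma inj_on_dir_of_slope: "inj_on dir_of_slope {w. cmod w = 1}"
proof (rule inj_onI)
  fix w z assume *: "w \<in> {w. cmod w = 1}" "z \<in> {w. cmod w = 1}" "dir_of_slope w = dir_of_slope z"
  have nz: "of_complex (csqrt (- u)) \<noteq> 0" if "cmod u = 1" for u
    using that by (auto simp flip: to_complex_eq_0_iff)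
  have mem: "of_complex (csqrt (- u)) \<in> vectors_of (dir_of_slope u)" if "cmod u = 1" for u
    unfolding dir_of_slope_def by (rule in_vectors_of_dir_of[OF nz[OF that]])
  have "chord_slope (to_complex (of_complex (csqrt (- w)))) = chord_slope (to_complex (of_complex (csqrt (- z))))"
    by (rule chord_param_parallel[OF chord_param_unit_circle, of _ "dir_of_slope z"])
      (use * nz mem[of w] mem[of z] in auto)
  then show "w = z"
    using * by (simp add: chord_slope_csqrt)
qed

text \<open>The chord between \<open>x\<close> and \<open>y\<close> meets infinity in the direction
  labelled by \<open>x * y\<close>. Labels are injective, so \<open>R\<close> has exactly as many
  points as \<open>W\<close>.\<close>

lemma blocking_set_of_products:
  assumes Z: "\<And>z. z \<in> Z \<Longrightarrow> cmod z = 1" and W: "\<And>w. w \<in> W \<Longrightarrow> cmod w = 1"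
    and ZW: "distinct_products Z \<subseteq> W"
  shows "blocks_lines (At_Inf ` dir_of_slope ` W) (Aff ` of_complex ` Z)"
    and "card (At_Inf ` dir_of_slope ` W) = card W"
proof -
  show "card (At_Inf ` dir_of_slope ` W) = card W"
  proof -
    have "card (At_Inf ` dir_of_slope ` W) = card (dir_of_slope ` W)"
      by (rule card_image) (auto simp: inj_on_def)
    also have "\<dots> = card W"
      by (rule card_image) (use inj_on_dir_of_slope W in \<open>auto intro: inj_on_subset\<close>)
    finally show ?thesis .
  qed
  show "blocks_lines (At_Inf ` dir_of_slope ` W) (Aff ` of_complex ` Z)"
    unfolding blocks_lines_def
  proof (intro ballI impI allI)
    fix p q L assume p: "p \<in> Aff ` of_complex ` Z" and q: "q \<in> Aff ` of_complex ` Z"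
      and pq: "p \<noteq> q" and L: "is_line L \<and> p \<in> L \<and> q \<in> L"
    obtain x y where x: "x \<in> Z" "p = Aff (of_complex x)" and y: "y \<in> Z" "q = Aff (of_complex y)"
      using p q by auto
    have neq: "x \<noteq> y"
      using pq x y by auto
    then have neq': "of_complex x \<noteq> of_complex y"
      by (metis to_complex_of_complex)
    have slope: "chord_slope (to_complex (of_complex y - of_complex x)) = y * x"
      using chord_slope_unit[of y x] Z x y neq by simp
    have "At_Inf (dir_of (of_complex y - of_complex x)) \<in> L"
      using line_through_two_affine_points(1) L x y neq' by metis
    moreover have "dir_of (of_complex y - of_complex x) = dir_of_slope (y * x)"
      using dir_of_eq_dir_of_slope[of "of_complex y - of_complex x"] slope neq' Z x y
      by (simp add: norm_mult)
    moreover have "y * x \<in> W"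
      using ZW distinct_productsI[of y Z x] x y neq by auto
    ultimately show "\<exists>r\<in>At_Inf ` dir_of_slope ` W. r \<in> L"
      by auto
  qed
qed

lemma general_position_unit:
  assumes Z: "\<And>z. z \<in> Z \<Longrightarrow> cmod z = 1"
  shows "general_position (Aff ` of_complex ` Z)"
  unfolding general_position_def
proof (intro ballI impI notI)
  fix p q r
  assume p: "p \<in> Aff ` of_complex ` Z" and q: "q \<in> Aff ` of_complex ` Z" and r: "r \<in> Aff ` of_complex ` Z"
    and neq: "p \<noteq> q \<and> q \<noteq> r \<and> p \<noteq> r" and "\<exists>L. is_line L \<and> {p, q, r} \<subseteq> L"
  then obtain L x y z where L: "is_line L" "{p, q, r} \<subseteq> L"
    and x: "x \<in> Z" "p = Aff (of_complex x)" and y: "y \<in> Z" "q = Aff (of_complex y)"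
    and z: "z \<in> Z" "r = Aff (of_complex z)"
    by blast
  let ?d = "dir_of (of_complex y - of_complex x)"
  have xy: "of_complex x \<noteq> of_complex y"
    using neq x y by auto
  have "of_complex z - of_complex x \<in> vectors_of ?d"
    using line_through_two_affine_points(2)[OF L(1) _ _ xy] L(2) x y z by auto
  moreover have "of_complex y - of_complex x \<in> vectors_of ?d"
    using xy by (intro in_vectors_of_dir_of) simp
  ultimately have "of_complex x = of_complex y \<or> of_complex y = of_complex z \<or> of_complex x = of_complex z"
    using Z x y z by (intro chord_param_not_collinear[OF chord_param_unit_circle]) auto
  then show False
    using neq x y z by auto
qed

text \<open>On the unit circle \<open>cnj w = 1 / w\<close>, so \<open>\<bar>\<alpha> w + \<beta> cnj w + \<gamma>\<bar> = 1\<close> is a polynomial equation of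
  degree four in \<open>w\<close>.\<close>

lemma ellipse_meets_circle:
  assumes T: "\<And>w. w \<in> T \<Longrightarrow> cmod w = 1" "card T > 4"
    and eq: "\<And>w. w \<in> T \<Longrightarrow> cmod (\<alpha> * w + \<beta> * cnj w + \<gamma>) = 1"
  shows "\<beta> = 0 \<and> \<gamma> = 0 \<or> \<alpha> = 0 \<and> \<gamma> = 0 \<or> \<alpha> = 0 \<and> \<beta> = 0"
proof -
  \<comment> \<open>Coefficients, constant term first, of w^2 times (|\<alpha> w + \<beta> / w +
    \<gamma>|^2 - 1) on the unit circle.\<close>
  define p where "p = [:\<beta> * cnj \<alpha>, \<beta> * cnj \<gamma> + \<gamma> * cnj \<alpha>,
    \<alpha> * cnj \<alpha> + \<beta> * cnj \<beta> + \<gamma> * cnj \<gamma> - 1, \<alpha> * cnj \<gamma> + \<gamma> * cnj \<beta>, \<alpha> * cnj \<beta>:]"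
  have "poly p w = 0" if w: "w \<in> T" for w
  proof -
    have "w \<noteq> 0"
      using T(1)[OF w] by auto
    have c: "cnj w = 1 / w"
      by (rule cnj_unit[OF T(1)[OF w]])
    have "(\<alpha> * w + \<beta> * cnj w + \<gamma>) * cnj (\<alpha> * w + \<beta> * cnj w + \<gamma>) = 1"
      using eq[OF w] complex_norm_square[of "\<alpha> * w + \<beta> * cnj w + \<gamma>"] by simp
    then have "(\<alpha> * w + \<beta> / w + \<gamma>) * (cnj \<alpha> / w + cnj \<beta> * w + cnj \<gamma>) = 1"
      by (simp add: c)
    then have "(w * (\<alpha> * w + \<beta> / w + \<gamma>)) * (w * (cnj \<alpha> / w + cnj \<beta> * w + cnj \<gamma>)) = w * w"
      by (metis (no_types, lifting) mult.assoc mult.left_commute mult.right_neutral)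
    moreover have "w * (\<alpha> * w + \<beta> / w + \<gamma>) = \<alpha> * w * w + \<beta> + \<gamma> * w"
      "w * (cnj \<alpha> / w + cnj \<beta> * w + cnj \<gamma>) = cnj \<alpha> + cnj \<beta> * w * w + cnj \<gamma> * w"
      using \<open>w \<noteq> 0\<close> by (simp_all add: field_simps)
    ultimately have "(\<alpha> * w * w + \<beta> + \<gamma> * w) * (cnj \<alpha> + cnj \<beta> * w * w + cnj \<gamma> * w) - w * w = 0"
      by simp
    then show ?thesis
      unfolding p_def by (simp add: algebra_simps)
  qed
  then have sub: "T \<subseteq> {w. poly p w = 0}"
    by auto
  have "p = 0"
  proof (rule ccontr)
    assume "p \<noteq> 0"
    then have "card T \<le> degree p"
      using card_poly_roots_bound[of p] poly_roots_finite[of p] card_mono[OF _ sub] by fastforce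
    also have "degree p \<le> 4"
      unfolding p_def by (simp add: degree_pCons_eq_if)
    finally show False
      using T(2) by simp
  qed
  \<comment> \<open>The top coefficient kills \<alpha> or \<beta>; the odd ones then kill a second
    of the three numbers.\<close>
  then have "\<alpha> * cnj \<beta> = 0" "\<alpha> * cnj \<gamma> + \<gamma> * cnj \<beta> = 0" "\<beta> * cnj \<gamma> + \<gamma> * cnj \<alpha> = 0"
    unfolding p_def by simp_all
  then show ?thesis
    by auto
qed

text \<open>A real-linear map of the complex plane is determined by its values E at 1 and F at i,
  which gives \<alpha> = (E - i F) / 2 and \<beta> = (E + i F) / 2.\<close>

lemma linear_to_complex:
  assumes "linear g"
  obtains \<alpha> \<beta> where "\<And>v. to_complex (g v) = \<alpha> * to_complex v + \<beta> * cnj (to_complex v)"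
proof -
  define E F where "E = to_complex (g (axis 1 1))" and "F = to_complex (g (axis 2 1))"
  have "to_complex (g v) = (E - \<i> * F) / 2 * to_complex v + (E + \<i> * F) / 2 * cnj (to_complex v)" for v
  proof -
    have v: "v = v $ 1 *\<^sub>R axis 1 1 + v $ 2 *\<^sub>R axis 2 1"
      by (simp add: vec_eq_iff forall_2 axis_def)
    have "g v = v $ 1 *\<^sub>R g (axis 1 1) + v $ 2 *\<^sub>R g (axis 2 1)"
      by (subst v) (simp add: linear_add[OF assms] linear_cmul[OF assms])
    then have "to_complex (g v) = v $ 1 *\<^sub>R E + v $ 2 *\<^sub>R F"
      unfolding E_def F_def by simp
    then show ?thesis
      by (simp add: complex_eq_iff to_complex_def field_simps)
  qed
  then show ?thesis
    using that by blast
qed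

text \<open>\<open>(3 + 4 \<i>) ^ m\<close> is congruent to \<open>3 + 4 \<i>\<close> modulo \<open>5\<close>, so its imaginary part does not vanish.\<close>

lemma not_root_of_unity_3_4_5:
  assumes "m > 0"
  shows "Complex (3 / 5) (4 / 5) ^ m \<noteq> 1"
proof -
  \<comment> \<open>The exponent starts at 1 because the zeroth power is not in this residue
    class.\<close>
  have cong: "\<exists>a b :: int. Complex 3 4 ^ Suc k = Complex (5 * of_int a + 3) (5 * of_int b + 4)" for k
  proof (induction k)
    case 0
    show ?case
      by (intro exI[of _ 0]) simp
  next
    case (Suc k)
    then obtain a b :: int where "Complex 3 4 ^ Suc k = Complex (5 * of_int a + 3) (5 * of_int b + 4)"
      by blast
    then have "Complex 3 4 ^ Suc (Suc k) =
        Complex (5 * of_int (3 * a - 4 * b - 2) + 3) (5 * of_int (3 * b + 4 * a + 4) + 4)"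
      by (subst power_Suc) (simp add: complex_eq_iff)
    then show ?case
      by blast
  qed
  obtain a b :: int where "Complex 3 4 ^ m = Complex (5 * of_int a + 3) (5 * of_int b + 4)"
    using cong[of "m - 1"] assms by auto
  then have "Im (Complex 3 4 ^ m) = of_int (5 * b + 4)"
    by simp
  moreover have "5 * b + 4 \<noteq> 0"
    by presburger
  ultimately have Im: "Im (Complex 3 4 ^ m) \<noteq> 0"
    by (metis of_int_eq_0_iff)
  have "Complex 3 4 = of_real 5 * Complex (3 / 5) (4 / 5)"
    by (simp add: complex_eq_iff)
  then have "Complex 3 4 ^ m = of_real (5 ^ m) * Complex (3 / 5) (4 / 5) ^ m"
    by (simp add: power_mult_distrib)
  then show ?thesis
    using Im by auto
qed

text \<open>The polygon is pulled back to unit numbers w with constant w^m. As more than four of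
  them go to unit numbers, the affine map acts on the circle as a rotation, a reflection or a
  constant. The constant is excluded by \<zeta> \<noteq> 1; otherwise \<zeta> is a ratio of two such
  w, hence an \<open>m\<close>-th root of unity.\<close>

lemma not_in_affine_regular_polygon:
  assumes Z: "\<And>z. z \<in> Z \<Longrightarrow> cmod z = 1" "card Z > 4"
    and \<zeta>: "\<zeta> \<in> Z" "1 \<in> Z" "\<And>m. m > 0 \<Longrightarrow> \<zeta> ^ m \<noteq> 1"
  shows "\<not> (\<exists>m V f. regular_polygon_vertices m V \<and> affine_map f \<and> Aff ` of_complex ` Z \<subseteq> Aff ` f ` V)"
proof
  assume "\<exists>m V f. regular_polygon_vertices m V \<and> affine_map f \<and> Aff ` of_complex ` Z \<subseteq> Aff ` f ` V"
  then obtain m V f where V: "regular_polygon_vertices m V" and f: "affine_map f"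
    and sub: "Aff ` of_complex ` Z \<subseteq> Aff ` f ` V"
    by blast
  obtain c \<rho> t where m: "m \<ge> 3" and V: "V = (\<lambda>k. c + \<rho> *\<^sub>R vector [cos (t + 2 * pi * real k / real m),
      sin (t + 2 * pi * real k / real m)]) ` {..<m}"
    using V unfolding regular_polygon_vertices_def by auto
  obtain g b where g: "linear g" and f: "f = (\<lambda>x. g x + b)"
    using f unfolding affine_map_def by auto
  obtain \<alpha>' \<beta>' where g': "\<And>v. to_complex (g v) = \<alpha>' * to_complex v + \<beta>' * cnj (to_complex v)"
    using linear_to_complex[OF g] by blast
  define \<alpha> \<beta> \<gamma> where "\<alpha> = \<alpha>' * of_real \<rho>" and "\<beta> = \<beta>' * of_real \<rho>"
    and "\<gamma> = to_complex (g c) + to_complex b"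
  have "\<exists>w. cmod w = 1 \<and> w ^ m = cis (real m * t) \<and> z = \<alpha> * w + \<beta> * cnj w + \<gamma>" if z: "z \<in> Z" for z
  proof -
    have "of_complex z \<in> f ` V"
      using sub z by auto
    then obtain k where k: "of_complex z = f (c + \<rho> *\<^sub>R vector [cos (t + 2 * pi * real k / real m),
        sin (t + 2 * pi * real k / real m)])"
      unfolding V by auto
    define w where "w = cis (t + 2 * pi * real k / real m)"
    have w: "to_complex (vector [cos (t + 2 * pi * real k / real m), sin (t + 2 * pi * real k / real m)]) = w"
      unfolding w_def by (simp add: complex_eq_iff)
    have "z = to_complex (of_complex z)"
      by simp
    also have "\<dots> = to_complex (g c) + \<rho> *\<^sub>R (\<alpha>' * w + \<beta>' * cnj w) + to_complex b"
      unfolding k f w[symmetric] g'[symmetric] by (simp add: linear_add[OF g] linear_cmul[OF g] del: to_complex_vector)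
    also have "\<dots> = \<alpha> * w + \<beta> * cnj w + \<gamma>"
      unfolding \<alpha>_def \<beta>_def \<gamma>_def by (simp add: scaleR_conv_of_real algebra_simps)
    finally have "z = \<alpha> * w + \<beta> * cnj w + \<gamma>" .
    moreover have "w ^ m = cis (real m * t)"
    proof -
      have "real m * (t + 2 * pi * real k / real m) = real m * t + 2 * pi * real k"
        using m by (simp add: field_simps)
      then have "w ^ m = cis (real m * t) * cis (2 * pi * real k)"
        unfolding w_def Complex.DeMoivre cis_mult by simp
      also have "cis (2 * pi * real k) = 1"
        by (rule cis_multiple_2pi) simp
      finally show ?thesis
        by simp
    qed
    moreover have "cmod w = 1"
      unfolding w_def by simp
    ultimately show ?thesis by blast
  qed
  then obtain w where w: "\<And>z. z \<in> Z \<Longrightarrow> cmod (w z) = 1" "\<And>z. z \<in> Z \<Longrightarrow> w z ^ m = cis (real m * t)"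
    and z: "\<And>z. z \<in> Z \<Longrightarrow> z = \<alpha> * w z + \<beta> * cnj (w z) + \<gamma>"
    by metis
  have "inj_on w Z"
    using z by (metis inj_onI)
  then have "card (w ` Z) > 4"
    using Z by (simp add: card_image)
  then have cases: "\<beta> = 0 \<and> \<gamma> = 0 \<or> \<alpha> = 0 \<and> \<gamma> = 0 \<or> \<alpha> = 0 \<and> \<beta> = 0"
    by (intro ellipse_meets_circle[of "w ` Z"]) (use w z Z in \<open>auto simp flip: z\<close>)
  have neq: "\<zeta> \<noteq> 1"
    using \<zeta>(3)[of 1] by auto
  have root: "(w x / w y) ^ m = 1" if "x \<in> Z" "y \<in> Z" for x y
    using w(2)[OF that(1)] w(2)[OF that(2)] by (simp add: power_divide)
  have nz: "w \<zeta> \<noteq> 0" "w 1 \<noteq> 0"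
    using w(1)[OF \<zeta>(1)] w(1)[OF \<zeta>(2)] by auto
  have "\<zeta> = w \<zeta> / w 1 \<or> \<zeta> = w 1 / w \<zeta>"
    using cases
  proof (elim disjE conjE)
    assume "\<beta> = 0" "\<gamma> = 0"
    then have "\<zeta> = \<alpha> * w \<zeta>" "1 = \<alpha> * w 1"
      using z[OF \<zeta>(1)] z[OF \<zeta>(2)] by simp_all
    then show ?thesis
      using nz by (metis mult.commute nonzero_eq_divide_eq mult.assoc mult_1)
  next
    assume "\<alpha> = 0" "\<gamma> = 0"
    then have "\<zeta> = \<beta> * (1 / w \<zeta>)" "1 = \<beta> * (1 / w 1)"
      using z[OF \<zeta>(1)] z[OF \<zeta>(2)] cnj_unit w(1) \<zeta>(1,2) by auto
    then have "\<beta> = w 1" "\<zeta> = \<beta> / w \<zeta>"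
      using nz by (simp_all add: field_simps)
    then show ?thesis
      by simp
  next
    assume "\<alpha> = 0" "\<beta> = 0"
    then have "\<zeta> = \<gamma>" "1 = \<gamma>"
      using z[OF \<zeta>(1)] z[OF \<zeta>(2)] by simp_all
    then show ?thesis
      using neq by simp
  qed
  then have "\<zeta> ^ m = 1"
    using root[OF \<zeta>(1,2)] root[OF \<zeta>(2,1)] by auto
  then show False
    using \<zeta>(3)[of m] m by simp
qed

lemma two_cosets_example:
  assumes n: "n > 100" "even n"
  shows "\<exists>Q P R. is_circle Q \<and> P \<subseteq> Q \<and> card P = n \<and> general_position P \<and>
    R \<subseteq> line_at_infinity \<and> real (card R) = 3 / 2 * real n \<and> blocks_lines R P \<and>
    \<not> (\<exists>m V f. regular_polygon_vertices m V \<and> affine_map f \<and> P \<subseteq> Aff ` f ` V)"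
proof -
  obtain k where k: "n = 2 * k"
    using n by (auto elim: evenE)
  \<comment> \<open>The 3-4-5 triangle supplies an explicit unit number of infinite order.\<close>
  define \<zeta> where "\<zeta> = Complex (3 / 5) (4 / 5)"
  have \<zeta>: "cmod \<zeta> = 1" "\<And>m. m > 0 \<Longrightarrow> \<zeta> ^ m \<noteq> 1"
    unfolding \<zeta>_def using not_root_of_unity_3_4_5 by (auto simp: cmod_def power2_eq_square)
  have \<zeta>0: "\<zeta> \<noteq> 0"
    using \<zeta>(1) by auto
  define H where "H = {z :: complex. z ^ k = 1}"
  have k0: "k > 0"
    using n k by simp
  have H: "finite H" "card H = k"
    unfolding H_def using k0 by (auto simp: card_roots_unity_eq finite_roots_unity)
  have Hmult: "x * y \<in> H" if "x \<in> H" "y \<in> H" for x y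
    using that unfolding H_def by (simp add: power_mult_distrib)
  have Hunit: "cmod z = 1" if "z \<in> H" for z
  proof -
    have "cmod z ^ k = 1 ^ k"
      using that unfolding H_def by (simp flip: norm_power)
    then show ?thesis
      using k0 by (subst (asm) power_eq_iff_eq_base) auto
  qed
  have coset: "card ((*) c ` H) = k" if "c \<noteq> 0" for c
    using that H by (simp add: card_image inj_on_def)
  \<comment> \<open>The \<open>k\<close>-th power is constant on a coset of \<open>H\<close>, so
    cosets are separated by comparing powers of their representatives.\<close>
  have coset_power: "z ^ k = c ^ k" if "z \<in> (*) c ` H" for z c
    using that unfolding H_def by (auto simp: power_mult_distrib)
  have disjoint: "(*) c ` H \<inter> (*) c' ` H = {}" if "c ^ k \<noteq> c' ^ k" for c c'
    using coset_power that by (metis disjoint_iff)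
  have pow: "\<zeta> ^ k \<noteq> 1" "(\<zeta>\<^sup>2) ^ k \<noteq> 1" "\<zeta> ^ k \<noteq> (\<zeta>\<^sup>2) ^ k"
  proof -
    show "\<zeta> ^ k \<noteq> 1"
      using \<zeta>(2) k0 by simp
    moreover have "(\<zeta>\<^sup>2) ^ k = \<zeta> ^ k * \<zeta> ^ k"
      by (simp add: power2_eq_square power_mult_distrib)
    ultimately show "\<zeta> ^ k \<noteq> (\<zeta>\<^sup>2) ^ k"
      using \<zeta>0 by simp
    show "(\<zeta>\<^sup>2) ^ k \<noteq> 1"
      using \<zeta>(2)[of "2 * k"] k0 by (simp add: power_mult)
  qed
  \<comment> \<open>Products of elements of \<open>H\<close> and \<zeta> \<open>H\<close> lie in
    three cosets, of total size 3 k = 3 n / 2.\<close>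
  define Z where "Z = (*) 1 ` H \<union> (*) \<zeta> ` H"
  define W where "W = (*) 1 ` H \<union> (*) \<zeta> ` H \<union> (*) (\<zeta>\<^sup>2) ` H"
  have cardZ: "card Z = n"
  proof -
    have "card Z = card ((*) 1 ` H) + card ((*) \<zeta> ` H)"
      unfolding Z_def using pow H by (intro card_Un_disjoint disjoint) auto
    then show ?thesis
      unfolding coset[OF one_neq_zero] coset[OF \<zeta>0] using k by simp
  qed
  have cardW: "card W = 3 * k"
  proof -
    have "card W = card Z + card ((*) (\<zeta>\<^sup>2) ` H)"
      unfolding W_def Z_def using pow H disjoint[of 1 "\<zeta>\<^sup>2"] disjoint[of \<zeta> "\<zeta>\<^sup>2"]
      by (intro card_Un_disjoint) auto
    then show ?thesis
      using coset[of "\<zeta>\<^sup>2"] \<zeta>0 cardZ k by simp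
  qed
  have unitZ: "cmod z = 1" if "z \<in> Z" for z
    using that Hunit \<zeta>(1) unfolding Z_def by (auto simp: norm_mult)
  have unitW: "cmod z = 1" if "z \<in> W" for z
    using that Hunit \<zeta>(1) unfolding W_def by (auto simp: norm_mult norm_power)
  have ZW: "distinct_products Z \<subseteq> W"
  proof
    fix s assume "s \<in> distinct_products Z"
    then obtain u v where uv: "u \<in> Z" "v \<in> Z" "s = u * v"
      unfolding distinct_products_def by auto
    have Z_cases: "\<exists>c x. c \<in> {1, \<zeta>} \<and> x \<in> H \<and> z = c * x" if "z \<in> Z" for z
      using that unfolding Z_def by auto
    obtain c x where c: "c \<in> {1, \<zeta>}" and x: "x \<in> H" "u = c * x"
      using Z_cases[OF uv(1)] by auto
    obtain c' y where c': "c' \<in> {1, \<zeta>}" and y: "y \<in> H" "v = c' * y"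
      using Z_cases[OF uv(2)] by auto
    have s: "s = (c * c') * (x * y)"
      unfolding uv(3) x(2) y(2) by simp
    have "c * c' \<in> {1, \<zeta>, \<zeta>\<^sup>2}"
      using c c' by (auto simp: power2_eq_square)
    then show "s \<in> W"
      using Hmult[OF x(1) y(1)] unfolding W_def s by auto
  qed
  have block: "blocks_lines (At_Inf ` dir_of_slope ` W) (Aff ` of_complex ` Z)"
    "card (At_Inf ` dir_of_slope ` W) = card W"
    using blocking_set_of_products[of Z W] unitZ unitW ZW by simp_all
  have gp: "general_position (Aff ` of_complex ` Z)"
    by (rule general_position_unit) (rule unitZ)
  have "inj of_complex"
    by (metis injI to_complex_of_complex)
  then have cardP: "card (Aff ` of_complex ` Z) = n"
    using cardZ by (simp add: card_image inj_on_def inj_def image_image)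
  have circle: "is_circle (Aff ` sphere 0 1)"
    unfolding is_circle_def by (intro exI[of _ 0] exI[of _ 1]) simp
  have PQ: "Aff ` of_complex ` Z \<subseteq> Aff ` sphere 0 1"
    using unitZ by (auto simp flip: norm_to_complex)
  have "1 \<in> H"
    unfolding H_def by simp
  then have "1 \<in> Z" "\<zeta> \<in> Z"
    unfolding Z_def by force+
  then have "\<not> (\<exists>m V f. regular_polygon_vertices m V \<and> affine_map f \<and> Aff ` of_complex ` Z \<subseteq> Aff ` f ` V)"
    using cardZ n \<zeta>(2) by (intro not_in_affine_regular_polygon[of Z \<zeta>] unitZ) auto
  moreover have "At_Inf ` dir_of_slope ` W \<subseteq> line_at_infinity"
    unfolding line_at_infinity_def by auto
  moreover have "real (card (At_Inf ` dir_of_slope ` W)) = 3 / 2 * real n"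
    unfolding block(2) cardW k by simp
  ultimately show ?thesis
    using circle PQ cardP block(1) gp by metis
qed

section \<open>Both halves combined\<close>

theorem theorem1p5:
  "(\<forall>(n::nat) P R c Q l.
      n > 100 \<and> card P = n \<and> general_position P \<and> R \<inter> P = {} \<and> blocks_lines R P \<and>
      is_quadric Q \<and> is_line l \<and> c = Q \<union> l \<and> P \<union> R \<subseteq> c \<and>
      n \<le> card R \<and> real (card R) < 3 / 2 * real n \<and> l = line_at_infinity \<longrightarrow>
        is_ellipse Q \<and> P \<subseteq> Q \<and>
        (\<exists>m X V f. m \<le> card R \<and> P = Aff ` X \<and> affine_map f \<and> bij f \<and>
           regular_polygon_vertices m V \<and> f ` X \<subseteq> V)) \<and>
   (\<forall>n::nat. n > 100 \<and> even n \<longrightarrow>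
      (\<exists>Q P R. is_circle Q \<and> P \<subseteq> Q \<and> card P = n \<and> general_position P \<and>
         R \<subseteq> line_at_infinity \<and> real (card R) = 3 / 2 * real n \<and> blocks_lines R P \<and>
         \<not> (\<exists>m V f. regular_polygon_vertices m V \<and> affine_map f \<and> P \<subseteq> Aff ` f ` V)))"
proof (rule conjI; intro allI impI)
  fix n :: nat and P R c Q l
  assume "n > 100 \<and> card P = n \<and> general_position P \<and> R \<inter> P = {} \<and> blocks_lines R P \<and>
      is_quadric Q \<and> is_line l \<and> c = Q \<union> l \<and> P \<union> R \<subseteq> c \<and>
      n \<le> card R \<and> real (card R) < 3 / 2 * real n \<and> l = line_at_infinity"
  then have *: "card P > 100" "general_position P" "R \<inter> P = {}" "blocks_lines R P" "is_quadric Q"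
      "P \<union> R \<subseteq> Q \<union> line_at_infinity" "card P \<le> card R" "2 * card R < 3 * card P"
    by auto
  \<comment> \<open>An infinite set has cardinality 0, so the lower bound on \<open>card R\<close>
    forces finiteness.\<close>
  then have "finite R"
    by (intro card_ge_0_finite) linarith
  then show "is_ellipse Q \<and> P \<subseteq> Q \<and>
      (\<exists>m X V f. m \<le> card R \<and> P = Aff ` X \<and> affine_map f \<and> bij f \<and>
         regular_polygon_vertices m V \<and> f ` X \<subseteq> V)"
    using * by (intro few_directions_polygon) simp_all
next
  fix n :: nat
  assume "n > 100 \<and> even n"
  then show "\<exists>Q P R. is_circle Q \<and> P \<subseteq> Q \<and> card P = n \<and> general_position P \<and>
      R \<subseteq> line_at_infinity \<and> real (card R) = 3 / 2 * real n \<and> blocks_lines R P \<and>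
      \<not> (\<exists>m V f. regular_polygon_vertices m V \<and> affine_map f \<and> P \<subseteq> Aff ` f ` V)"
    by (intro two_cosets_example) simp_all
qed

end
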